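(* Let $F$ be a field of characteristic zero and let $\mathcal{A}$ be a semisimple (finite-dimensional left) Leibniz algebra over $F$, i.e. $\mathrm{rad}(\mathcal{A})=\mathrm{Leib}(\mathcal{A})$. Then $\mathcal{A}$ is a complete Leibniz algebra.
   Context: All Leibniz algebras are finite-dimensional left Leibniz algebras: vector spaces $\mathcal{A}$ over a field $F$ with a bilinear product $[\,,\,]$ such that every left multiplication operator $L_x(y)=[x,y]$ is a derivation of the product, i.e. $[x,[y,z]]=[[x,y],z]+[y,[x,z]]$. Ideals are two-sided. A linear map $\delta:\mathcal{A}\to\mathcal{A}$ is a derivation if $\delta([x,y])=[\delta(x),y]+[x,\delta(y)]$ for all $x,y$; $Der(\mathcal{A})$ denotes the Lie algebra of all derivations. $\mathrm{Leib}(\mathcal{A})=\mathrm{span}\{[x,x]\mid x\in\mathcal{A}\}$, which is an abelian ideal, and $\mathcal{A}/\mathrm{Leib}(\mathcal{A})$ is a Lie algebra. $\mathcal{A}$ is solvable if $\mathcal{A}^{(m)}=\{0\}$ for some positive integer $m$, where $\mathcal{A}^{(1)}=\mathcal{A}$, $\mathcal{A}^{(i)}=[\mathcal{A}^{(i-1)},\mathcal{A}^{(i-1)}]$; $\mathrm{rad}(\mathcal{A})$ is the maximal solvable ideal of $\mathcal{A}$. $\mathcal{A}$ is semisimple if $\mathrm{rad}(\mathcal{A})=\mathrm{Leib}(\mathcal{A})$. A derivation $\delta\in Der(\mathcal{A})$ is inner if there exists $x\in\mathcal{A}$ with $\mathrm{im}(\delta-L_x)\subseteq\mathrm{Leib}(\mathcal{A})$.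 $\mathcal{A}$ is complete if (1) the center $Z(\mathcal{A}/\mathrm{Leib}(\mathcal{A}))$ of the Lie algebra $\mathcal{A}/\mathrm{Leib}(\mathcal{A})$ is $\{0\}$, and (2) every derivation of $\mathcal{A}$ is inner (in the sense just defined). *)

theory Defs
  imports Complex_Main "HOL-Library.Set_Algebras"
begin

text \<open>
  A finite-dimensional left Leibniz algebra: the underlying vector space is the whole
  type \<open>'b\<close>, with scalar multiplication \<open>scale\<close>; the parameter \<open>Basis\<close> of
  \<^locale>\<open>finite_dimensional_vector_space\<close> only witnesses finite dimension, and none of the
  notions below depends on it.
\<close>

locale leibniz_algebra = finite_dimensional_vector_space scale Basis
  for scale :: "'a::field \<Rightarrow> 'b::ab_group_add \<Rightarrow> 'b"
    and Basis :: "'b set" +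
  fixes bracket :: "'b \<Rightarrow> 'b \<Rightarrow> 'b"
  assumes linear_bracket_right: "Vector_Spaces.linear scale scale (\<lambda>y. bracket x y)"
    and linear_bracket_left: "Vector_Spaces.linear scale scale (\<lambda>x. bracket x y)"
    and left_leibniz:
      "bracket x (bracket y z) = bracket (bracket x y) z + bracket y (bracket x z)"
begin

definition Leib :: "'b set" where
  "Leib = span {bracket x x | x. True}"

definition leibniz_ideal :: "'b set \<Rightarrow> bool" where
  "leibniz_ideal I \<longleftrightarrow> subspace I \<and> (\<forall>x\<in>I. \<forall>y. bracket x y \<in> I \<and> bracket y x \<in> I)"

definition bracket_span :: "'b set \<Rightarrow> 'b set \<Rightarrow> 'b set" where
  "bracket_span S T = span {bracket x y | x y. x \<in> S \<and> y \<in> T}"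

text \<open>The derived series, counted from \<open>0\<close>: \<open>derived_series S n\<close> is the \<open>(n + 1)\<close>-st term in the
  numbering whose first term is \<open>S\<close>.\<close>

primrec derived_series :: "'b set \<Rightarrow> nat \<Rightarrow> 'b set" where
  "derived_series S 0 = S"
| "derived_series S (Suc n) = bracket_span (derived_series S n) (derived_series S n)"

definition solvable :: "'b set \<Rightarrow> bool" where
  "solvable S \<longleftrightarrow> (\<exists>n. derived_series S n = {0})"

text \<open>The greatest solvable ideal with respect to inclusion; see \<open>rad_greatest\<close> below for
  its existence.\<close>

definition rad :: "'b set" where
  "rad = (GREATEST I. leibniz_ideal I \<and> solvable I)"

definition semisimple :: bool where
  "semisimple \<longleftrightarrow> rad = Leib"

definition derivation :: "('b \<Rightarrow> 'b) \<Rightarrow> bool" where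
  "derivation \<delta> \<longleftrightarrow> Vector_Spaces.linear scale scale \<delta> \<and>
     (\<forall>x y. \<delta> (bracket x y) = bracket (\<delta> x) y + bracket x (\<delta> y))"

definition inner_derivation :: "('b \<Rightarrow> 'b) \<Rightarrow> bool" where
  "inner_derivation \<delta> \<longleftrightarrow> derivation \<delta> \<and> (\<exists>x. range (\<lambda>y. \<delta> y - bracket x y) \<subseteq> Leib)"

text \<open>The Lie algebra \<open>A / Leib(A)\<close>, consisting of the cosets of \<open>Leib\<close>; its zero is \<open>Leib\<close>
  itself. The bracket of two cosets is described without choosing representatives; see
  \<open>quot_bracket_coset\<close> and \<open>quot_bracket_self\<close> below.\<close>

definition quot :: "'b set set" where
  "quot = range (\<lambda>x. x +o Leib)"

definition quot_bracket :: "'b set \<Rightarrow> 'b set \<Rightarrow> 'b set" where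
  "quot_bracket X Y = (\<Union>x\<in>X. \<Union>y\<in>Y. bracket x y +o Leib)"

definition quot_center :: "'b set set" where
  "quot_center = {X \<in> quot. \<forall>Y\<in>quot. quot_bracket X Y = Leib}"

definition complete_leibniz :: bool where
  "complete_leibniz \<longleftrightarrow> quot_center = {Leib} \<and> (\<forall>\<delta>. derivation \<delta> \<longrightarrow> inner_derivation \<delta>)"

lemma bracket_add_right: "bracket x (y + z) = bracket x y + bracket x z"
  using linear_bracket_right[of x] by (simp add: Vector_Spaces.linear_def module_hom_iff)

lemma bracket_add_left: "bracket (x + y) z = bracket x z + bracket y z"
  using linear_bracket_left[of z] by (simp add: Vector_Spaces.linear_def module_hom_iff)

lemma bracket_scale_right: "bracket x (scale c y) = scale c (bracket x y)"
  using linear_bracket_right[of x] by (simp add: Vector_Spaces.linear_def module_hom_iff)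

lemma bracket_scale_left: "bracket (scale c x) y = scale c (bracket x y)"
  using linear_bracket_left[of y] by (simp add: Vector_Spaces.linear_def module_hom_iff)

lemma bracket_0_left [simp]: "bracket 0 y = 0"
  using bracket_add_left[of 0 0 y] by simp

lemma bracket_0_right [simp]: "bracket y 0 = 0"
  using bracket_add_right[of y 0 0] by simp

lemma square_in_Leib: "bracket x x \<in> Leib"
  unfolding Leib_def by (rule span_base) blast

lemma subspace_Leib: "subspace Leib"
  unfolding Leib_def by simp

lemma bracket_Leib_left:
  assumes "l \<in> Leib" shows "bracket l y = 0"
  using assms unfolding Leib_def
proof (induction rule: span_induct_alt)
  case base then show ?case by simp
next
  case (step c s l)
  then obtain x where "s = bracket x x" by blast
  moreover have "bracket (bracket x x) y = 0"
    using left_leibniz[of x x y] by simp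
  ultimately show ?case using step by (simp add: bracket_add_left bracket_scale_left)
qed

lemma bracket_sym_in_Leib: "bracket x y + bracket y x \<in> Leib"
proof -
  have "bracket x y + bracket y x = bracket (x + y) (x + y) - bracket x x - bracket y y"
    by (simp add: bracket_add_left bracket_add_right)
  then show ?thesis
    using square_in_Leib subspace_Leib by (simp add: subspace_diff)
qed

lemma bracket_Leib_right:
  assumes "l \<in> Leib" shows "bracket y l \<in> Leib"
  using bracket_sym_in_Leib[of y l] bracket_Leib_left[OF assms] by simp

lemma leibniz_ideal_Leib: "leibniz_ideal Leib"
  unfolding leibniz_ideal_def
  using subspace_Leib bracket_Leib_left bracket_Leib_right subspace_0 by auto

lemma quot_bracket_coset:
  "quot_bracket (x +o Leib) (y +o Leib) = bracket x y +o Leib"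
proof -
  have "bracket (x + l) (y + m) +o Leib = bracket x y +o Leib"
    if "l \<in> Leib" "m \<in> Leib" for l m
  proof -
    have eq: "bracket (x + l) (y + m) = bracket x y + bracket x m"
      using that bracket_Leib_left by (simp add: bracket_add_left bracket_add_right)
    have k: "bracket x m \<in> Leib" using that bracket_Leib_right by blast
    have "z \<in> (bracket x y + bracket x m) +o Leib \<longleftrightarrow> z \<in> bracket x y +o Leib" for z
    proof
      assume "z \<in> (bracket x y + bracket x m) +o Leib"
      then obtain l where "l \<in> Leib" "z = bracket x y + (bracket x m + l)"
        by (auto simp: elt_set_plus_def add.assoc)
      then show "z \<in> bracket x y +o Leib"
        using k subspace_add[OF subspace_Leib] by (auto simp: elt_set_plus_def)
    next
      assume "z \<in> bracket x y +o Leib"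
      then obtain l where l: "l \<in> Leib" "z = bracket x y + l"
        by (auto simp: elt_set_plus_def)
      then have "z = bracket x y + bracket x m + (l - bracket x m)" by simp
      then show "z \<in> (bracket x y + bracket x m) +o Leib"
        using l k subspace_diff[OF subspace_Leib] unfolding elt_set_plus_def by blast
    qed
    then show ?thesis using eq by auto
  qed
  then have "\<And>u v. u \<in> x +o Leib \<Longrightarrow> v \<in> y +o Leib \<Longrightarrow> bracket u v +o Leib = bracket x y +o Leib"
    unfolding elt_set_plus_def[of x] elt_set_plus_def[of y] by auto
  moreover have "x \<in> x +o Leib" "y \<in> y +o Leib"
    using subspace_0[OF subspace_Leib] by (force simp: elt_set_plus_def)+
  ultimately show ?thesis unfolding quot_bracket_def by blast
qed

lemma quot_bracket_self: "X \<in> quot \<Longrightarrow> quot_bracket X X = Leib"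
proof -
  assume "X \<in> quot"
  then obtain x where "X = x +o Leib" unfolding quot_def by blast
  then have "quot_bracket X X = bracket x x +o Leib" by (simp add: quot_bracket_coset)
  also have "\<dots> = Leib"
  proof (intro subset_antisym subsetI)
    fix z assume "z \<in> bracket x x +o Leib"
    then show "z \<in> Leib"
      using square_in_Leib subspace_add[OF subspace_Leib] by (auto simp: elt_set_plus_def)
  next
    fix z assume "z \<in> Leib"
    moreover have "z = bracket x x + (z - bracket x x)" by simp
    ultimately show "z \<in> bracket x x +o Leib"
      using square_in_Leib subspace_diff[OF subspace_Leib] unfolding elt_set_plus_def by blast
  qed
  finally show ?thesis .
qed

lemma bracket_span_mono:
  "S \<subseteq> S' \<Longrightarrow> T \<subseteq> T' \<Longrightarrow> bracket_span S T \<subseteq> bracket_span S' T'"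
  unfolding bracket_span_def by (rule span_mono) blast

lemma derived_series_mono: "S \<subseteq> T \<Longrightarrow> derived_series S n \<subseteq> derived_series T n"
  by (induction n) (auto intro: bracket_span_mono[THEN subsetD])

lemma derived_series_add:
  "derived_series S (m + n) = derived_series (derived_series S m) n"
  by (induction n) auto

lemma subspace_derived_series: "subspace S \<Longrightarrow> subspace (derived_series S n)"
  by (cases n) (auto simp: bracket_span_def)

lemma leibniz_ideal_sum:
  assumes "leibniz_ideal I" "leibniz_ideal J"
  shows "leibniz_ideal {x + y | x y. x \<in> I \<and> y \<in> J}"
  unfolding leibniz_ideal_def
proof (intro conjI ballI allI)
  show "subspace {x + y | x y. x \<in> I \<and> y \<in> J}"
    using assms by (simp add: leibniz_ideal_def subspace_sums)
next
  fix u y assume "u \<in> {x + y | x y. x \<in> I \<and> y \<in> J}"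
  then obtain i j where ij: "u = i + j" "i \<in> I" "j \<in> J" by blast
  have "bracket u y = bracket i y + bracket j y" using ij by (simp add: bracket_add_left)
  moreover have "bracket i y \<in> I" "bracket j y \<in> J" using assms ij by (auto simp: leibniz_ideal_def)
  ultimately show "bracket u y \<in> {x + y | x y. x \<in> I \<and> y \<in> J}" by blast
  have "bracket y u = bracket y i + bracket y j" using ij by (simp add: bracket_add_right)
  moreover have "bracket y i \<in> I" "bracket y j \<in> J" using assms ij by (auto simp: leibniz_ideal_def)
  ultimately show "bracket y u \<in> {x + y | x y. x \<in> I \<and> y \<in> J}" by blast
qed

lemma derived_series_sum:
  assumes "leibniz_ideal I" "leibniz_ideal J"
  shows "derived_series {x + y | x y. x \<in> I \<and> y \<in> J} n
           \<subseteq> {x + y | x y. x \<in> derived_series I n \<and> y \<in> J}"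
proof (induction n)
  case 0 then show ?case by simp
next
  case (Suc n)
  have "subspace I" "subspace J" using assms by (auto simp: leibniz_ideal_def)
  let ?R = "{x + y | x y. x \<in> derived_series I (Suc n) \<and> y \<in> J}"
  have sub: "subspace ?R"
    using \<open>subspace I\<close> \<open>subspace J\<close> subspace_derived_series subspace_sums by blast
  have "bracket u v \<in> ?R"
    if "u \<in> derived_series {x + y | x y. x \<in> I \<and> y \<in> J} n"
       "v \<in> derived_series {x + y | x y. x \<in> I \<and> y \<in> J} n" for u v
  proof -
    have "u \<in> {x + y | x y. x \<in> derived_series I n \<and> y \<in> J}"
         "v \<in> {x + y | x y. x \<in> derived_series I n \<and> y \<in> J}"
      using that Suc.IH by (auto dest: subsetD)
    then obtain a j b k where *: "u = a + j" "v = b + k" "a \<in> derived_series I n"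
        "b \<in> derived_series I n" "j \<in> J" "k \<in> J"
      by (elim CollectE exE conjE) blast
    have "bracket u v = bracket a b + (bracket a k + bracket j b + bracket j k)"
      using * by (simp add: bracket_add_left bracket_add_right algebra_simps)
    moreover have "bracket a b \<in> derived_series I (Suc n)"
      using * by (auto simp: bracket_span_def intro!: span_base)
    moreover have "bracket a k + bracket j b + bracket j k \<in> J"
      using * assms(2) by (auto simp: leibniz_ideal_def intro!: subspace_add)
    ultimately show ?thesis by blast
  qed
  then have "{bracket x y | x y. x \<in> derived_series {x + y | x y. x \<in> I \<and> y \<in> J} n
      \<and> y \<in> derived_series {x + y | x y. x \<in> I \<and> y \<in> J} n} \<subseteq> ?R" by blast
  from span_minimal[OF this sub] show ?case
    unfolding derived_series.simps(2) bracket_span_def .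
qed

lemma solvable_sum:
  assumes "leibniz_ideal I" "solvable I" "leibniz_ideal J" "solvable J"
  shows "solvable {x + y | x y. x \<in> I \<and> y \<in> J}" (is "solvable ?S")
proof -
  obtain m n where mn: "derived_series I m = {0}" "derived_series J n = {0}"
    using assms by (auto simp: solvable_def)
  have "derived_series ?S m \<subseteq> J"
    using derived_series_sum[OF assms(1,3), of m] mn by auto
  then have "derived_series ?S (m + n) \<subseteq> {0}"
    using derived_series_mono[of "derived_series ?S m" J n] mn
    by (simp add: derived_series_add)
  moreover have "subspace (derived_series ?S (m + n))"
    using leibniz_ideal_sum[OF assms(1,3)] by (simp add: leibniz_ideal_def subspace_derived_series)
  then have "0 \<in> derived_series ?S (m + n)" by (rule subspace_0)
  ultimately show ?thesis unfolding solvable_def by blast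
qed

lemma rad_greatest:
  shows leibniz_ideal_rad: "leibniz_ideal rad"
    and solvable_rad: "solvable rad"
    and rad_upper: "leibniz_ideal I \<Longrightarrow> solvable I \<Longrightarrow> I \<subseteq> rad"
proof -
  let ?P = "\<lambda>I. leibniz_ideal I \<and> solvable I"
  have "?P {0}"
    by (auto simp: leibniz_ideal_def solvable_def subspace_def intro: exI[of _ 0])
  moreover have "\<forall>I. ?P I \<longrightarrow> dim I < Suc (dim UNIV)"
    unfolding less_Suc_eq_le by (intro allI impI dim_subset subset_UNIV)
  ultimately have "\<exists>R. ?P R \<and> (\<forall>I. ?P I \<longrightarrow> dim I \<le> dim R)"
    by (intro ex_has_greatest_nat[of ?P "{0}" dim "Suc (dim UNIV)"]) (auto intro: less_imp_le)
  then obtain R where R: "?P R" and max: "\<And>I. ?P I \<Longrightarrow> dim I \<le> dim R"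
    by blast
  have up: "I \<subseteq> R" if I: "?P I" for I
  proof -
    let ?S = "{x + y | x y. x \<in> I \<and> y \<in> R}"
    have S: "?P ?S" using I R leibniz_ideal_sum solvable_sum by blast
    have z: "0 \<in> I" "0 \<in> R" using I R by (auto simp: leibniz_ideal_def subspace_0)
    then have "R \<subseteq> ?S" "I \<subseteq> ?S" by force+
    moreover have "R = ?S"
      using subspace_dim_equal[of R ?S] R S max[OF S] \<open>R \<subseteq> ?S\<close> by (simp add: leibniz_ideal_def)
    ultimately show ?thesis by simp
  qed
  have "rad = R" unfolding rad_def by (rule Greatest_equality) (use R up in auto)
  then show "leibniz_ideal rad" "solvable rad" "leibniz_ideal I \<Longrightarrow> solvable I \<Longrightarrow> I \<subseteq> rad"
    using R up by auto
qed

end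

end

theory Submission
  imports Defs "HOL-Library.Function_Algebras" "HOL-Algebra.Algebraic_Closure_Type"
begin

text \<open>
  Let \<open>\<kappa>(x, y) = tr(L\<^sub>x L\<^sub>y)\<close>, the traces being taken on the whole algebra \<open>A\<close>. Its radical \<open>R\<close> is an
  ideal, and it is solvable (Cartan's criterion), so that \<open>R \<subseteq> rad(A) = Leib(A)\<close>. A derivation
  \<open>\<delta>\<close> gives the functional \<open>x \<mapsto> tr(\<delta> L\<^sub>x)\<close>, which vanishes on \<open>R\<close> and hence equals \<open>\<kappa>(y, \<cdot>)\<close> for
  some \<open>y\<close>. Then \<open>\<epsilon> = \<delta> - L\<^sub>y\<close> is a derivation with \<open>\<kappa>(\<epsilon> x, z) = tr(\<epsilon> L\<^bsub>[x,z]\<^esub>) = 0\<close>, that is,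
  \<open>\<epsilon>\<close> maps into \<open>R \<subseteq> Leib(A)\<close>. The center is trivial because the preimage of the center of
  \<open>A / Leib(A)\<close> is a solvable ideal.

  For Cartan's criterion, let \<open>x \<in> [R, A]\<close>, and let \<open>f\<close> be an additive map from the algebraic
  closure to the rationals. If \<open>g\<close> is a polynomial that is congruent to \<open>f(\<lambda>)\<close> modulo a high
  power of \<open>X - \<lambda>\<close> for every eigenvalue \<open>\<lambda>\<close> of \<open>L\<^sub>x\<close>, then \<open>ad g(L\<^sub>x)\<close> is a polynomial in
  \<open>ad L\<^sub>x\<close>. This yields \<open>tr(L\<^sub>x g(L\<^sub>x)) = 0\<close>, i.e. \<open>\<Sum> \<lambda> f(\<lambda>) = 0\<close> over the eigenvalues, and applying
  \<open>f\<close> gives \<open>\<Sum> f(\<lambda>)\<^sup>2 = 0\<close>. As \<open>f\<close> is arbitrary, all eigenvalues vanish; so \<open>L\<^sub>x\<close> is nilpotent for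
  all \<open>x \<in> [R, R]\<close>, and Engel's theorem shows that \<open>R\<close> is solvable.
\<close>

section \<open>Interpolation and replicas\<close>

definition comaximal :: "'a::comm_ring_1 \<Rightarrow> 'a \<Rightarrow> bool" where
  "comaximal p q \<longleftrightarrow> (\<exists>u v. u * p + v * q = 1)"

lemma comaximal_sym: "comaximal p q \<Longrightarrow> comaximal q p"
  unfolding comaximal_def by (metis add.commute)

text \<open>Multiply the two Bezout identities: every term of the product except
  \<open>(v * v') * (q * r)\<close> contains the factor \<open>p\<close>.\<close>

lemma comaximal_mult:
  assumes "comaximal p q" "comaximal p r"
  shows "comaximal p (q * r)"
proof -
  obtain u v u' v' where "u * p + v * q = 1" "u' * p + v' * r = 1"
    using assms unfolding comaximal_def by blast
  then have "(u * p + v * q) * (u' * p + v' * r) = 1" by simp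
  then have "(u * u' * p + u * v' * r + v * q * u') * p + (v * v') * (q * r) = 1"
    by (simp add: algebra_simps)
  then show ?thesis unfolding comaximal_def by blast
qed

lemma comaximal_one: "comaximal p 1"
  unfolding comaximal_def by (rule exI[of _ 0], rule exI[of _ 1]) simp

lemma comaximal_power: "comaximal p q \<Longrightarrow> comaximal p (q ^ n)"
  by (induction n) (auto simp: comaximal_one comaximal_mult)

lemma comaximal_prod:
  "finite S \<Longrightarrow> (\<And>i. i \<in> S \<Longrightarrow> comaximal p (h i)) \<Longrightarrow> comaximal p (prod h S)"
  by (induction S rule: finite_induct) (auto simp: comaximal_one comaximal_mult)

text \<open>In \<open>r = u * p * r + v * q * r\<close> the factor \<open>r\<close> supplies
  \<open>q\<close> in the first summand and \<open>p\<close> in the second.\<close>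

lemma comaximal_mult_dvd:
  assumes "comaximal p q" "p dvd r" "q dvd r"
  shows "p * q dvd r"
proof -
  obtain u v where "u * p + v * q = 1" using assms(1) unfolding comaximal_def by blast
  then have "r = u * p * r + v * q * r" by (metis distrib_right mult_1)
  moreover have "p * q dvd u * p * r"
    using mult_dvd_mono[OF dvd_refl[of p] assms(3)] dvd_mult by (metis mult.assoc)
  moreover have "p * q dvd v * q * r"
    using mult_dvd_mono[OF assms(2) dvd_refl[of q]] dvd_mult by (metis mult.assoc mult.commute)
  ultimately show ?thesis by (metis dvd_add)
qed

lemma comaximal_prod_dvd:
  assumes "finite S" "\<And>i j. i \<in> S \<Longrightarrow> j \<in> S \<Longrightarrow> i \<noteq> j \<Longrightarrow> comaximal (h i) (h j)"
    "\<And>i. i \<in> S \<Longrightarrow> h i dvd r"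
  shows "prod h S dvd r"
  using assms
proof (induction S rule: finite_induct)
  case empty
  then show ?case by simp
next
  case (insert i S)
  have "comaximal (h i) (prod h S)"
  proof (rule comaximal_prod)
    fix j assume "j \<in> S"
    then show "comaximal (h i) (h j)" using insert by (intro insert.prems(1)) auto
  qed (fact insert)
  moreover have "prod h S dvd r" using insert by auto
  ultimately show ?case using insert by (simp add: comaximal_mult_dvd)
qed

lemma comaximal_linear_powers:
  fixes a b :: "'a::field"
  assumes "a \<noteq> b"
  shows "comaximal ([:-a, 1:] ^ m) ([:-b, 1:] ^ n)"
proof -
  have "[:1 / (b - a):] * [:-a, 1:] + [:- 1 / (b - a):] * [:-b, 1:] = 1"
    using assms by (simp add: one_pCons divide_simps)
  then have "comaximal [:-a, 1:] [:-b, 1:]" unfolding comaximal_def by blast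
  then show ?thesis by (rule comaximal_power[OF comaximal_sym[OF comaximal_power[OF comaximal_sym]]])
qed

text \<open>Chinese remainder theorem: \<open>e a\<close> is a Bezout multiple of the product of the
  other factors, hence 1 modulo its own factor and 0 modulo the others. The \<open>e a\<close> thus
  represent orthogonal idempotents modulo the full product.\<close>

lemma partial_fraction_idempotents:
  fixes S :: "'a::field set"
  assumes "finite S"
  obtains e where
    "\<And>a. a \<in> S \<Longrightarrow> (\<Prod>b\<in>S. [:-b, 1:] ^ n) dvd e a * [:-a, 1:] ^ n"
    "\<And>a. a \<in> S \<Longrightarrow> [:-a, 1:] ^ n dvd 1 - e a"
    "(\<Prod>b\<in>S. [:-b, 1:] ^ n) dvd 1 - (\<Sum>a\<in>S. e a)"
proof -
  define h where "h = (\<lambda>a::'a. [:-a, 1:] ^ n)"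
  have "\<exists>v. h a dvd 1 - v * prod h (S - {a})" for a
  proof -
    have "comaximal (h a) (prod h (S - {a}))"
      using assms unfolding h_def
      by (intro comaximal_prod comaximal_linear_powers) auto
    then obtain u v where "u * h a + v * prod h (S - {a}) = 1"
      unfolding comaximal_def by blast
    then have "1 - v * prod h (S - {a}) = u * h a" by (metis add_diff_cancel_right')
    then show ?thesis by (metis dvd_triv_right)
  qed
  then obtain v where v: "\<And>a. h a dvd 1 - v a * prod h (S - {a})" by metis
  define e where "e = (\<lambda>a. v a * prod h (S - {a}))"
  have 1: "prod h S dvd e a * h a" if "a \<in> S" for a
    using that assms unfolding e_def
    by (simp add: prod.remove[of S a] mult.commute mult.left_commute)
  have 2: "h a dvd 1 - e a" for a using v by (simp add: e_def)
  have 3: "prod h S dvd 1 - (\<Sum>a\<in>S. e a)"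
  proof (rule comaximal_prod_dvd[OF assms])
    fix i j assume "i \<in> S" "j \<in> S" "i \<noteq> j"
    then show "comaximal (h i) (h j)" unfolding h_def by (intro comaximal_linear_powers)
  next
    fix a assume a: "a \<in> S"
    have "h a dvd e b" if "b \<in> S - {a}" for b
      using that a assms unfolding e_def by (auto intro!: dvd_mult dvd_prodI)
    then have "h a dvd (\<Sum>b\<in>S - {a}. e b)" by (rule dvd_sum)
    then have "h a dvd (1 - e a) - (\<Sum>b\<in>S - {a}. e b)" using 2 by (rule dvd_diff[rotated])
    then show "h a dvd 1 - (\<Sum>a\<in>S. e a)" using a assms by (simp add: sum.remove algebra_simps)
  qed
  show thesis using that[of e] 1 2 3 unfolding h_def by blast
qed

lemma linear_powers_interpolation:
  fixes S :: "'a::field set" and f :: "'a \<Rightarrow> 'a"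
  assumes "finite S"
  obtains g where "\<And>a. a \<in> S \<Longrightarrow> [:-a, 1:] ^ n dvd g - [:f a:]"
proof -
  obtain e where e:
    "\<And>a. a \<in> S \<Longrightarrow> (\<Prod>b\<in>S. [:-b, 1:] ^ n) dvd e a * [:-a, 1:] ^ n"
    "\<And>a. a \<in> S \<Longrightarrow> [:-a, 1:] ^ n dvd 1 - e a"
    "(\<Prod>b\<in>S. [:-b, 1:] ^ n) dvd 1 - (\<Sum>a\<in>S. e a)"
    using partial_fraction_idempotents[OF assms] by metis
  \<comment> \<open>\<open>[:-b, 1:] ^ n\<close> is invertible modulo \<open>[:-a, 1:] ^ n\<close>,
    so it can be cancelled from the first property of \<open>e b\<close>.\<close>
  have small: "[:-a, 1:] ^ n dvd e b" if ab: "a \<in> S" "b \<in> S" "a \<noteq> b" for a b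
  proof -
    let ?p = "[:-a, 1:] ^ n" and ?q = "[:-b, 1:] ^ n"
    have "?p dvd (\<Prod>b\<in>S. [:-b, 1:] ^ n)" using ab assms by (intro dvd_prodI) auto
    then have d: "?p dvd e b * ?q" using e(1)[of b] ab dvd_trans by blast
    have "comaximal ?p ?q" using ab by (intro comaximal_linear_powers)
    then obtain u v where "u * ?p + v * ?q = 1" unfolding comaximal_def by blast
    then have "e b * (u * ?p + v * ?q) = e b" by simp
    then have "e b = (e b * u) * ?p + v * (e b * ?q)" by (simp only: distrib_left mult_ac)
    moreover have "?p dvd (e b * u) * ?p + v * (e b * ?q)"
      by (rule dvd_add[OF dvd_triv_right dvd_mult[OF d]])
    ultimately show ?thesis by (simp only:)
  qed
  \<comment> \<open>The interpolant is the combination of the \<open>e b\<close> with coefficients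
    \<open>f b\<close>; modulo the power at \<open>a\<close> only \<open>e a\<close> survives, and
    it is 1 there.\<close>
  have "[:-a, 1:] ^ n dvd (\<Sum>b\<in>S. [:f b:] * e b) - [:f a:]" if a: "a \<in> S" for a
  proof -
    have "(\<Sum>b\<in>S. [:f b:] * e b) - [:f a:]
        = (\<Sum>b\<in>S - {a}. [:f b:] * e b) - [:f a:] * (1 - e a)"
      using a assms by (simp add: sum.remove algebra_simps smult_diff_right)
    moreover have "[:-a, 1:] ^ n dvd (\<Sum>b\<in>S - {a}. [:f b:] * e b)"
      using small a by (intro dvd_sum dvd_mult) auto
    moreover have "[:-a, 1:] ^ n dvd [:f a:] * (1 - e a)" using e(2) a by (intro dvd_mult) auto
    ultimately show ?thesis by (simp only: dvd_diff)
  qed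
  then show thesis using that by blast
qed

section \<open>Polynomials in two variables modulo two generators\<close>

definition eval_in :: "'a::comm_ring_1 poly poly \<Rightarrow> 'a poly \<Rightarrow> 'a poly poly" where
  "eval_in u p = poly (map_poly (\<lambda>c. [:[:c:]:]) p) u"

lemma eval_in_0 [simp]: "eval_in u 0 = 0"
  by (simp add: eval_in_def)

lemma eval_in_pCons [simp]: "eval_in u (pCons c p) = [:[:c:]:] + u * eval_in u p"
  by (simp add: eval_in_def map_poly_pCons)

lemma eval_in_add: "eval_in u (p + q) = eval_in u p + eval_in u q"
  by (induction p q rule: poly_induct2) (simp_all add: algebra_simps)

lemma eval_in_smult: "eval_in u (smult c p) = [:[:c:]:] * eval_in u p"
  by (induction p) (simp_all add: algebra_simps)

lemma eval_in_diff: "eval_in u (p - q) = eval_in u p - eval_in u q"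
  using eval_in_add[of u "p - q" q] by simp

lemma eval_in_mult: "eval_in u (p * q) = eval_in u p * eval_in u q"
  by (induction p) (simp_all add: eval_in_add eval_in_smult algebra_simps)

lemma eval_in_1 [simp]: "eval_in u 1 = 1"
  by (simp add: one_pCons)

lemma eval_in_power: "eval_in u (p ^ n) = eval_in u p ^ n"
  by (induction n) (simp_all add: eval_in_mult)

lemma eval_in_sum: "eval_in u (sum f S) = (\<Sum>i\<in>S. eval_in u (f i))"
  by (induction S rule: infinite_finite_induct) (simp_all add: eval_in_add)

lemma eval_in_dvd: "p dvd q \<Longrightarrow> eval_in u p dvd eval_in u q"
  by (metis dvd_def eval_in_mult)

lemma eval_in_linear: "eval_in u [:-c, 1:] = u - [:[:c:]:]"
  by (simp flip: one_pCons)

definition two_ideal :: "'a::comm_ring_1 \<Rightarrow> 'a \<Rightarrow> 'a set" where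
  "two_ideal a b = {x * a + y * b | x y. True}"

lemma two_ideal_add: "p \<in> two_ideal a b \<Longrightarrow> q \<in> two_ideal a b \<Longrightarrow> p + q \<in> two_ideal a b"
proof -
  assume "p \<in> two_ideal a b" "q \<in> two_ideal a b"
  then obtain x y x' y' where "p = x * a + y * b" "q = x' * a + y' * b"
    unfolding two_ideal_def by blast
  then have "p + q = (x + x') * a + (y + y') * b" by (simp add: algebra_simps)
  then show ?thesis unfolding two_ideal_def by blast
qed

lemma two_ideal_mult: "p \<in> two_ideal a b \<Longrightarrow> c * p \<in> two_ideal a b"
proof -
  assume "p \<in> two_ideal a b"
  then obtain x y where "p = x * a + y * b" unfolding two_ideal_def by blast
  then have "c * p = (c * x) * a + (c * y) * b" by (simp add: algebra_simps)
  then show ?thesis unfolding two_ideal_def by blast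
qed

lemma two_ideal_diff: "p \<in> two_ideal a b \<Longrightarrow> q \<in> two_ideal a b \<Longrightarrow> p - q \<in> two_ideal a b"
  using two_ideal_add[of p a b "(-1) * q"] two_ideal_mult[of q a b "-1"] by simp

lemma two_ideal_dvd1: "a dvd p \<Longrightarrow> p \<in> two_ideal a b"
proof (elim dvdE)
  fix k assume "p = a * k"
  then have "p = k * a + 0 * b" by (simp add: mult.commute)
  then show ?thesis unfolding two_ideal_def by blast
qed

lemma two_ideal_dvd2: "b dvd p \<Longrightarrow> p \<in> two_ideal a b"
proof (elim dvdE)
  fix k assume "p = b * k"
  then have "p = 0 * a + k * b" by (simp add: mult.commute)
  then show ?thesis unfolding two_ideal_def by blast
qed

lemma two_ideal_sum: "(\<And>i. i \<in> S \<Longrightarrow> f i \<in> two_ideal a b) \<Longrightarrow> sum f S \<in> two_ideal a b"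
  by (induction S rule: infinite_finite_induct)
    (auto intro: two_ideal_add two_ideal_dvd1)

text \<open>In every binomial term of degree \<open>2 * n\<close> one of the two exponents is at
  least \<open>n\<close>.\<close>

lemma diff_power_two_ideal: "(x - y) ^ (2 * n) \<in> two_ideal (x ^ n) (y ^ n)"
proof -
  have "(x - y) ^ (2 * n) = (\<Sum>k\<le>2 * n. of_nat (2 * n choose k) * x ^ k * (- y) ^ (2 * n - k))"
    using binomial_ring[of x "-y" "2 * n"] by simp
  also have "\<dots> \<in> two_ideal (x ^ n) (y ^ n)"
  proof (rule two_ideal_sum)
    fix k
    show "of_nat (2 * n choose k) * x ^ k * (- y) ^ (2 * n - k) \<in> two_ideal (x ^ n) (y ^ n)"
    proof (cases "n \<le> k")
      case True
      then show ?thesis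
        by (intro two_ideal_dvd1 dvd_mult2 dvd_mult[OF le_imp_power_dvd]) auto
    next
      case False
      have "y ^ n dvd y ^ (2 * n - k)" using False by (intro le_imp_power_dvd) auto
      also have "\<dots> dvd (- y) ^ (2 * n - k)"
        by (metis dvd_minus_iff dvd_refl dvd_power_same)
      finally show ?thesis by (intro two_ideal_dvd2 dvd_mult)
    qed
  qed
  finally show ?thesis .
qed

abbreviation var_s :: "'a::comm_ring_1 poly poly" where "var_s \<equiv> [:0, 1:]"
abbreviation var_t :: "'a::comm_ring_1 poly poly" where "var_t \<equiv> [:[:0, 1:]:]"

lemma diff_regroup:
  fixes w :: "'a::comm_ring_1"
  shows "w * (x - y - z) = w * (x - a) - w * (y - b) - w * (z - (a - b))"
  by (simp add: algebra_simps)

lemma mult_regroup: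
  fixes u :: "'a::comm_ring_1"
  shows "u * v * ((x * a + y * b) * r) = (v * x * r) * (u * a) + (u * y * r) * (v * b)"
  by (simp add: algebra_simps)

text \<open>As \<open>u\<close> and \<open>v\<close> are 1 modulo the ideal, \<open>h\<close> is
  congruent to \<open>u * v * h\<close>. Later \<open>u\<close> and \<open>v\<close> are the sums of
  the local idempotents in \<open>s\<close> and in \<open>t\<close>.\<close>

lemma two_ideal_localize:
  assumes "1 - u \<in> two_ideal a b" "1 - v \<in> two_ideal a b" "u * v * h \<in> two_ideal a b"
  shows "h \<in> two_ideal a b"
proof -
  have "h = (h * (1 - u) + (h * u) * (1 - v)) + u * v * h" by (simp add: algebra_simps)
  then show ?thesis
    using two_ideal_add[OF two_ideal_add[OF two_ideal_mult[OF assms(1), of h]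
      two_ideal_mult[OF assms(2), of "h * u"]] assms(3)] by simp
qed

text \<open>Read \<open>s\<close> and \<open>t\<close> as right and left multiplication by an operator annihilated by \<open>m\<close>: up to
  sign, \<open>ad g\<close> is then the polynomial \<open>q\<close> in \<open>ad\<close> of that operator. The inclusion is checked after
  multiplication by \<open>e\<^sub>a(s) e\<^sub>b(t)\<close>, where everything is locally constant.\<close>

lemma replica:
  fixes f :: "'a::field \<Rightarrow> 'a" and S :: "'a set" and n :: nat
  defines "m \<equiv> \<Prod>a\<in>S. [:-a, 1:] ^ n"
  assumes "finite S" and add: "\<And>x y. f (x - y) = f x - f y"
    and g: "\<And>a. a \<in> S \<Longrightarrow> [:-a, 1:] ^ n dvd g - [:f a:]"
  obtains q where "eval_in var_s g - eval_in var_t g - eval_in (var_s - var_t) q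
    \<in> two_ideal (eval_in var_s m) (eval_in var_t m)"
proof -
  \<comment> \<open>The exponent is doubled because \<open>s - t - (a - b)\<close> is the difference
    of \<open>s - a\<close> and \<open>t - b\<close>, so its power \<open>2 * n\<close> lies in the
    ideal of their \<open>n\<close>-th powers.\<close>
  obtain q where q: "\<And>c. c \<in> (\<lambda>(a, b). a - b) ` (S \<times> S) \<Longrightarrow> [:-c, 1:] ^ (2 * n) dvd q - [:f c:]"
    using linear_powers_interpolation[of "(\<lambda>(a, b). a - b) ` (S \<times> S)"] assms(2)
    by (metis finite_SigmaI finite_imageI)
  obtain e where e: "\<And>a. a \<in> S \<Longrightarrow> m dvd e a * [:-a, 1:] ^ n"
    "m dvd 1 - (\<Sum>a\<in>S. e a)"
    using partial_fraction_idempotents[OF assms(2)] unfolding m_def by metis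
  let ?J = "two_ideal (eval_in var_s m) (eval_in var_t m)"
  let ?h = "eval_in var_s g - eval_in var_t g - eval_in (var_s - var_t) q"
  let ?E = "\<Sum>a\<in>S. e a"
  have loc: "eval_in var_s (e a) * eval_in var_t (e b) * ?h \<in> ?J" if ab: "a \<in> S" "b \<in> S" for a b
  proof -
    let ?u = "eval_in var_s (e a)" and ?v = "eval_in var_t (e b)"
    let ?sa = "var_s - [:[:a:]:]" and ?tb = "var_t - [:[:b:]:]"
    have sa: "?u * ?sa ^ n \<in> ?J"
      using eval_in_dvd[OF e(1)[OF ab(1)], of var_s]
      by (intro two_ideal_dvd1) (simp only: eval_in_mult eval_in_power eval_in_linear)
    have tb: "?v * ?tb ^ n \<in> ?J"
      using eval_in_dvd[OF e(1)[OF ab(2)], of var_t]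
      by (intro two_ideal_dvd2) (simp only: eval_in_mult eval_in_power eval_in_linear)
    have c: "eval_in w [:c:] = [:[:c:]:]" for w and c :: 'a by simp
    obtain r where "g - [:f a:] = [:-a, 1:] ^ n * r" using g[OF ab(1)] by (elim dvdE)
    then have "eval_in var_s g - [:[:f a:]:] = ?sa ^ n * eval_in var_s r"
      by (metis eval_in_diff eval_in_mult eval_in_power eval_in_linear c)
    then have 1: "?u * ?v * (eval_in var_s g - [:[:f a:]:]) \<in> ?J"
      using two_ideal_mult[OF sa, of "?v * eval_in var_s r"] by (simp only: mult_ac)
    obtain r where "g - [:f b:] = [:-b, 1:] ^ n * r" using g[OF ab(2)] by (elim dvdE)
    then have "eval_in var_t g - [:[:f b:]:] = ?tb ^ n * eval_in var_t r"
      by (metis eval_in_diff eval_in_mult eval_in_power eval_in_linear c)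
    then have 2: "?u * ?v * (eval_in var_t g - [:[:f b:]:]) \<in> ?J"
      using two_ideal_mult[OF tb, of "?u * eval_in var_t r"] by (simp only: mult_ac)
    have "[:-(a - b), 1:] ^ (2 * n) dvd q - [:f (a - b):]"
      by (rule q) (use ab in force)
    then obtain r where "q - [:f (a - b):] = [:-(a - b), 1:] ^ (2 * n) * r" by (elim dvdE)
    from arg_cong[OF this, of "eval_in (var_s - var_t)"]
    have r: "eval_in (var_s - var_t) q - [:[:f (a - b):]:]
        = ((var_s - var_t) - [:[:a - b:]:]) ^ (2 * n) * eval_in (var_s - var_t) r"
      by (simp only: eval_in_diff eval_in_mult eval_in_power eval_in_linear c)
    have d: "(var_s - var_t) - [:[:a - b:]:] = ?sa - ?tb" by simp
    obtain x y where xy: "(?sa - ?tb) ^ (2 * n) = x * ?sa ^ n + y * ?tb ^ n"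
      using diff_power_two_ideal[of ?sa ?tb n] unfolding two_ideal_def by blast
    have "?u * ?v * (eval_in (var_s - var_t) q - [:[:f (a - b):]:])
      = (?v * x * eval_in (var_s - var_t) r) * (?u * ?sa ^ n)
        + (?u * y * eval_in (var_s - var_t) r) * (?v * ?tb ^ n)"
      unfolding r d xy by (rule mult_regroup)
    then have 3: "?u * ?v * (eval_in (var_s - var_t) q - [:[:f (a - b):]:]) \<in> ?J"
      by (simp only: two_ideal_add[OF two_ideal_mult[OF sa] two_ideal_mult[OF tb]])
    \<comment> \<open>Additivity of \<open>f\<close> makes the three local constants cancel.\<close>
    have k: "[:[:f (a - b):]:] = [:[:f a:]:] - [:[:f b:]:]" by (simp add: add)
    have "?u * ?v * ?h = ?u * ?v * (eval_in var_s g - [:[:f a:]:])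
        - ?u * ?v * (eval_in var_t g - [:[:f b:]:])
        - ?u * ?v * (eval_in (var_s - var_t) q - [:[:f (a - b):]:])"
      unfolding k by (rule diff_regroup)
    then show ?thesis by (simp only: two_ideal_diff[OF two_ideal_diff[OF 1 2] 3])
  qed
  have s: "1 - eval_in var_s ?E \<in> ?J"
    using eval_in_dvd[OF e(2), of var_s] by (intro two_ideal_dvd1) (simp only: eval_in_diff eval_in_1)
  have t: "1 - eval_in var_t ?E \<in> ?J"
    using eval_in_dvd[OF e(2), of var_t] by (intro two_ideal_dvd2) (simp only: eval_in_diff eval_in_1)
  have "eval_in var_s ?E * eval_in var_t ?E * ?h
      = (\<Sum>a\<in>S. \<Sum>b\<in>S. eval_in var_s (e a) * eval_in var_t (e b) * ?h)"
    unfolding eval_in_sum sum_product by (simp only: sum_distrib_right)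
  also have "\<dots> \<in> ?J" by (intro two_ideal_sum loc)
  finally have "?h \<in> ?J"
    by (rule two_ideal_localize[OF s t])
  then show thesis by (rule that)
qed

section \<open>Linear functionals on polynomials in two variables\<close>

text \<open>The linear functional sending \<open>X ^ j\<close> to \<open>w j\<close>. Later
  \<open>w j\<close> is a trace containing the \<open>j\<close>-th power of an operator, so that
  traces of polynomials in the operator become values of \<open>umbral\<close>.\<close>

definition umbral :: "(nat \<Rightarrow> 'a::comm_ring_1) \<Rightarrow> 'a poly \<Rightarrow> 'a" where
  "umbral w p = (\<Sum>j\<le>degree p. coeff p j * w j)"

lemma umbral_eq: "degree p \<le> n \<Longrightarrow> umbral w p = (\<Sum>j\<le>n. coeff p j * w j)"
  unfolding umbral_def by (rule sum.mono_neutral_left) (auto simp: coeff_eq_0)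

lemma umbral_0 [simp]: "umbral w 0 = 0"
  by (simp add: umbral_def)

lemma umbral_pCons: "umbral w (pCons c p) = c * w 0 + umbral (\<lambda>j. w (Suc j)) p"
proof -
  have "umbral w (pCons c p) = (\<Sum>j\<le>Suc (degree p). coeff (pCons c p) j * w j)"
    by (rule umbral_eq) (simp add: degree_pCons_le)
  also have "\<dots> = c * w 0 + umbral (\<lambda>j. w (Suc j)) p"
    unfolding sum.atMost_Suc_shift umbral_def by simp
  finally show ?thesis .
qed

lemma umbral_add: "umbral w (p + q) = umbral w p + umbral w q"
proof -
  let ?n = "max (degree p) (degree q)"
  have "umbral w (p + q) = (\<Sum>j\<le>?n. coeff (p + q) j * w j)"
    by (rule umbral_eq) (simp add: degree_add_le)
  moreover have "umbral w p = (\<Sum>j\<le>?n. coeff p j * w j)" by (rule umbral_eq) simp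
  moreover have "umbral w q = (\<Sum>j\<le>?n. coeff q j * w j)" by (rule umbral_eq) simp
  ultimately show ?thesis by (simp add: distrib_right sum.distrib)
qed

lemma umbral_smult: "umbral w (smult c p) = c * umbral w p"
proof -
  have "umbral w (smult c p) = (\<Sum>j\<le>degree p. coeff (smult c p) j * w j)"
    by (rule umbral_eq) (simp add: degree_smult_le)
  then show ?thesis by (simp add: umbral_def sum_distrib_left mult.assoc)
qed

lemma umbral_diff_left: "umbral (\<lambda>j. w j - w' j) p = umbral w p - umbral w' p"
  by (simp add: umbral_def right_diff_distrib sum_subtractf)

lemma umbral_zero_left [simp]: "umbral (\<lambda>j. 0) p = 0"
  by (simp add: umbral_def)

lemma umbral_add_left: "umbral (\<lambda>j. w j + w' j) p = umbral w p + umbral w' p"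
  by (simp add: umbral_def distrib_left sum.distrib)

lemma umbral_mult_left: "umbral (\<lambda>j. c * w j) p = c * umbral w p"
  by (simp add: umbral_def sum_distrib_left mult_ac)

lemma umbral_power: "umbral (\<lambda>j. x ^ j) p = poly p x"
  by (simp add: umbral_def poly_altdef)

lemma umbral_power_Suc: "umbral (\<lambda>j. x ^ Suc j) p = x * poly p x"
  by (simp only: power_Suc umbral_mult_left umbral_power)

text \<open>The linear functional sending \<open>s ^ i * t ^ j\<close> to \<open>w i j\<close>;
  \<open>s\<close> is the outer variable.\<close>

definition umbral2 :: "(nat \<Rightarrow> nat \<Rightarrow> 'a::comm_ring_1) \<Rightarrow> 'a poly poly \<Rightarrow> 'a" where
  "umbral2 w P = (\<Sum>i\<le>degree P. umbral (w i) (coeff P i))"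

lemma umbral2_eq: "degree P \<le> n \<Longrightarrow> umbral2 w P = (\<Sum>i\<le>n. umbral (w i) (coeff P i))"
  unfolding umbral2_def by (rule sum.mono_neutral_left) (auto simp: coeff_eq_0)

lemma umbral2_0 [simp]: "umbral2 w 0 = 0"
  by (simp add: umbral2_def)

lemma umbral2_pCons: "umbral2 w (pCons c P) = umbral (w 0) c + umbral2 (\<lambda>i. w (Suc i)) P"
proof -
  have "umbral2 w (pCons c P) = (\<Sum>i\<le>Suc (degree P). umbral (w i) (coeff (pCons c P) i))"
    by (rule umbral2_eq) (simp add: degree_pCons_le)
  also have "\<dots> = umbral (w 0) c + umbral2 (\<lambda>i. w (Suc i)) P"
    unfolding sum.atMost_Suc_shift umbral2_def by simp
  finally show ?thesis .
qed

lemma umbral2_add: "umbral2 w (P + Q) = umbral2 w P + umbral2 w Q"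
proof -
  let ?n = "max (degree P) (degree Q)"
  have "umbral2 w (P + Q) = (\<Sum>i\<le>?n. umbral (w i) (coeff (P + Q) i))"
    by (rule umbral2_eq) (simp add: degree_add_le)
  moreover have "umbral2 w P = (\<Sum>i\<le>?n. umbral (w i) (coeff P i))" by (rule umbral2_eq) simp
  moreover have "umbral2 w Q = (\<Sum>i\<le>?n. umbral (w i) (coeff Q i))" by (rule umbral2_eq) simp
  ultimately show ?thesis by (simp add: umbral_add sum.distrib)
qed

lemma umbral2_diff: "umbral2 w (P - Q) = umbral2 w P - umbral2 w Q"
  using umbral2_add[of w "P - Q" Q] by simp

lemma umbral2_zero_left [simp]: "umbral2 (\<lambda>i j. 0) P = 0"
  by (simp add: umbral2_def)

lemma umbral2_diff_left: "umbral2 (\<lambda>i j. w i j - w' i j) P = umbral2 w P - umbral2 w' P"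
  by (simp add: umbral2_def umbral_diff_left sum_subtractf)

lemma umbral2_add_left: "umbral2 (\<lambda>i j. w i j + w' i j) P = umbral2 w P + umbral2 w' P"
  by (simp add: umbral2_def umbral_add_left sum.distrib)

lemma umbral2_mult_left: "umbral2 (\<lambda>i j. c * w i j) P = c * umbral2 w P"
  by (simp add: umbral2_def umbral_mult_left sum_distrib_left)

lemma umbral2_const_mult: "umbral2 w ([:[:c:]:] * P) = c * umbral2 w P"
proof -
  have "umbral2 w ([:[:c:]:] * P) = (\<Sum>i\<le>degree P. umbral (w i) (coeff ([:[:c:]:] * P) i))"
    by (rule umbral2_eq) (simp add: degree_smult_le)
  then show ?thesis by (simp add: umbral2_def umbral_smult sum_distrib_left)
qed

lemma umbral2_var_s: "umbral2 w (var_s * P) = umbral2 (\<lambda>i. w (Suc i)) P"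
  by (simp add: umbral2_pCons)

lemma umbral2_var_t: "umbral2 w (var_t * P) = umbral2 (\<lambda>i j. w i (Suc j)) P"
proof -
  have "umbral2 w (var_t * P) = (\<Sum>i\<le>degree P. umbral (w i) (coeff (var_t * P) i))"
    by (rule umbral2_eq) (simp add: degree_smult_le)
  then show ?thesis by (simp add: umbral2_def umbral_pCons)
qed

text \<open>Each factor \<open>s\<close> shifts the first index of \<open>w\<close>, which is why
  the induction generalises over \<open>w\<close>.\<close>

lemma umbral2_eval_s:
  "umbral2 w (eval_in var_s g * P) = umbral2 (\<lambda>i j. umbral (\<lambda>k. w (i + k) j) g) P"
proof (induction g arbitrary: w)
  case 0
  then show ?case by simp
next
  case (pCons c g)
  have "umbral2 w (eval_in var_s (pCons c g) * P)
      = umbral2 w ([:[:c:]:] * P) + umbral2 w (var_s * (eval_in var_s g * P))"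
    by (simp only: eval_in_pCons distrib_right mult.assoc umbral2_add)
  also have "\<dots> = c * umbral2 w P + umbral2 (\<lambda>i. w (Suc i)) (eval_in var_s g * P)"
    by (simp only: umbral2_const_mult umbral2_var_s)
  finally show ?case
    by (simp only: pCons umbral_pCons umbral2_add_left umbral2_mult_left add_Suc_right add_Suc add_0_right)
qed

lemma umbral2_eval_t:
  "umbral2 w (eval_in var_t g * P) = umbral2 (\<lambda>i j. umbral (\<lambda>k. w i (j + k)) g) P"
proof (induction g arbitrary: w)
  case 0
  then show ?case by simp
next
  case (pCons c g)
  have "umbral2 w (eval_in var_t (pCons c g) * P)
      = umbral2 w ([:[:c:]:] * P) + umbral2 w (var_t * (eval_in var_t g * P))"
    by (simp only: eval_in_pCons distrib_right mult.assoc umbral2_add)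
  also have "\<dots> = c * umbral2 w P + umbral2 (\<lambda>i j. w i (Suc j)) (eval_in var_t g * P)"
    by (simp only: umbral2_const_mult umbral2_var_t)
  finally show ?case
    by (simp only: pCons umbral_pCons umbral2_add_left umbral2_mult_left add_Suc_right add_Suc add_0_right)
qed

text \<open>Multiplication by \<open>s - t\<close> passes from \<open>w k\<close> to
  \<open>w (Suc k)\<close>, so powers of \<open>s - t\<close> are absorbed into the index
  \<open>k\<close>.\<close>

lemma umbral2_eval_diff:
  assumes "\<And>k i j. w (Suc k) i j = w k (Suc i) j - w k i (Suc j)"
  shows "umbral2 (w 0) (eval_in (var_s - var_t) g * P) = umbral (\<lambda>k. umbral2 (w k) P) g"
  using assms
proof (induction g arbitrary: w)
  case 0
  then show ?case by simp
next
  case (pCons c g)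
  have w1: "w 1 = (\<lambda>i j. w 0 (Suc i) j - w 0 i (Suc j))"
    using pCons.prems[of 0] by (intro ext) simp
  have "umbral2 (w 0) (eval_in (var_s - var_t) (pCons c g) * P)
      = umbral2 (w 0) ([:[:c:]:] * P) + (umbral2 (w 0) (var_s * (eval_in (var_s - var_t) g * P))
        - umbral2 (w 0) (var_t * (eval_in (var_s - var_t) g * P)))"
    by (simp only: eval_in_pCons distrib_right left_diff_distrib mult.assoc umbral2_add umbral2_diff)
  also have "\<dots> = c * umbral2 (w 0) P + umbral2 (w 1) (eval_in (var_s - var_t) g * P)"
    by (simp only: umbral2_const_mult umbral2_var_s umbral2_var_t umbral2_diff_left[symmetric]
        w1)
  also have "umbral2 (w 1) (eval_in (var_s - var_t) g * P) = umbral (\<lambda>k. umbral2 (w (Suc k)) P) g"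
    unfolding One_nat_def by (rule pCons.IH) (fact pCons.prems)
  finally show ?case by (simp only: umbral_pCons)
qed

lemma umbral2_1: "umbral2 w 1 = w 0 0"
  by (simp add: one_pCons umbral2_pCons umbral_pCons)

text \<open>Apply \<open>umbral2 (w 0)\<close> to the inclusion of \<open>replica\<close>. The ideal
  contributes 0, since \<open>p\<close> divides \<open>m\<close> and annihilates \<open>w 0\<close>
  in both indices; the polynomial in \<open>s - t\<close> contributes only multiples of
  \<open>w k 0 0 = 0\<close>. What remains is \<open>g\<close> in \<open>s\<close> minus
  \<open>g\<close> in \<open>t\<close>.\<close>

lemma replica_annihilates:
  fixes f :: "'a::field \<Rightarrow> 'a" and S :: "'a set" and n :: nat and w :: "nat \<Rightarrow> nat \<Rightarrow> nat \<Rightarrow> 'a"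
  defines "m \<equiv> \<Prod>a\<in>S. [:-a, 1:] ^ n"
  assumes S: "finite S" and f: "\<And>x y. f (x - y) = f x - f y"
    and g: "\<And>a. a \<in> S \<Longrightarrow> [:-a, 1:] ^ n dvd g - [:f a:]"
    and w: "\<And>k i j. w (Suc k) i j = w k (Suc i) j - w k i (Suc j)" "\<And>k. w k 0 0 = 0"
    and p: "p dvd m" "\<And>i j. umbral (\<lambda>k. w 0 (i + k) j) p = 0" "\<And>i j. umbral (\<lambda>k. w 0 i (j + k)) p = 0"
  shows "umbral (\<lambda>k. w 0 k 0 - w 0 0 k) g = 0"
proof -
  obtain q where "eval_in var_s g - eval_in var_t g - eval_in (var_s - var_t) q
      \<in> two_ideal (eval_in var_s m) (eval_in var_t m)"
    using replica[OF S f g] unfolding m_def by blast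
  then obtain x y where xy: "eval_in var_s g - eval_in var_t g - eval_in (var_s - var_t) q
      = x * eval_in var_s m + y * eval_in var_t m" unfolding two_ideal_def by blast
  obtain r where m: "m = p * r" using p(1) by (elim dvdE)
  have "umbral2 (w 0) (x * eval_in var_s m) = umbral2 (w 0) (eval_in var_s p * (x * eval_in var_s r))"
    unfolding m by (simp only: eval_in_mult mult_ac)
  also have "\<dots> = 0" unfolding umbral2_eval_s p by simp
  finally have 1: "umbral2 (w 0) (x * eval_in var_s m) = 0" .
  have "umbral2 (w 0) (y * eval_in var_t m) = umbral2 (w 0) (eval_in var_t p * (y * eval_in var_t r))"
    unfolding m by (simp only: eval_in_mult mult_ac)
  also have "\<dots> = 0" unfolding umbral2_eval_t p by simp
  finally have 2: "umbral2 (w 0) (y * eval_in var_t m) = 0" .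
  have 3: "umbral2 (w 0) (eval_in (var_s - var_t) q) = 0"
    using umbral2_eval_diff[of w q 1, OF w(1)] by (simp only: mult_1_right umbral2_1 w(2) umbral_zero_left)
  have 4: "umbral2 (w 0) (eval_in var_s g) = umbral (\<lambda>k. w 0 k 0) g"
    using umbral2_eval_s[of "w 0" g 1] by (simp only: mult_1_right umbral2_1 add_0)
  have 5: "umbral2 (w 0) (eval_in var_t g) = umbral (\<lambda>k. w 0 0 k) g"
    using umbral2_eval_t[of "w 0" g 1] by (simp only: mult_1_right umbral2_1 add_0)
  have "umbral2 (w 0) (eval_in var_s g - eval_in var_t g - eval_in (var_s - var_t) q) = 0"
    unfolding xy umbral2_add 1 2 by simp
  then have "umbral (\<lambda>k. w 0 k 0) g - umbral (\<lambda>k. w 0 0 k) g = 0"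
    unfolding umbral2_diff 3 4 5 by simp
  then show ?thesis unfolding umbral_diff_left .
qed

section \<open>Polynomials in an operator and traces over the algebraic closure\<close>

text \<open>A locale of its own: definitions made in \<open>vector_space\<close> itself would be shadowed by their
  instances for real vector spaces.\<close>

locale operator_space = vector_space scale
  for scale :: "'a::field \<Rightarrow> 'b::ab_group_add \<Rightarrow> 'b"
begin

definition endo :: "('b \<Rightarrow> 'b) \<Rightarrow> bool" where
  "endo \<phi> \<longleftrightarrow> Vector_Spaces.linear scale scale \<phi>"

lemma endo_iff: "endo \<phi> \<longleftrightarrow> (\<forall>x y. \<phi> (x + y) = \<phi> x + \<phi> y) \<and> (\<forall>c x. \<phi> (scale c x) = scale c (\<phi> x))"
  by (simp add: endo_def Vector_Spaces.linear_def module_hom_iff vector_space_axioms module_axioms)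

lemma endo_add: "endo \<phi> \<Longrightarrow> \<phi> (x + y) = \<phi> x + \<phi> y"
  and endo_scale: "endo \<phi> \<Longrightarrow> \<phi> (scale c x) = scale c (\<phi> x)"
  by (auto simp: endo_iff)

lemma endo_0: "endo \<phi> \<Longrightarrow> \<phi> 0 = 0"
  using endo_scale[of \<phi> 0 0] by simp

lemma endo_diff: "endo \<phi> \<Longrightarrow> \<phi> (x - y) = \<phi> x - \<phi> y"
  using endo_add[of \<phi> "x - y" y] by simp

lemma endo_sum: "endo \<phi> \<Longrightarrow> \<phi> (sum h S) = (\<Sum>i\<in>S. \<phi> (h i))"
  by (induction S rule: infinite_finite_induct) (auto simp: endo_0 endo_add)

lemma endo_comp: "endo \<phi> \<Longrightarrow> endo Y \<Longrightarrow> endo (\<lambda>v. \<phi> (Y v))"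
  by (simp add: endo_iff)

lemma endo_funpow: "endo \<phi> \<Longrightarrow> endo (\<phi> ^^ j)"
  by (induction j) (auto simp: endo_iff)

definition poly_op :: "('b \<Rightarrow> 'b) \<Rightarrow> 'a poly \<Rightarrow> 'b \<Rightarrow> 'b" where
  "poly_op \<phi> p v = (\<Sum>j\<le>degree p. scale (coeff p j) ((\<phi> ^^ j) v))"

lemma poly_op_eq: "degree p \<le> n \<Longrightarrow> poly_op \<phi> p v = (\<Sum>j\<le>n. scale (coeff p j) ((\<phi> ^^ j) v))"
  unfolding poly_op_def by (rule sum.mono_neutral_left) (auto simp: coeff_eq_0)

lemma poly_op_0 [simp]: "poly_op \<phi> 0 v = 0"
  by (simp add: poly_op_def)

lemma poly_op_pCons: "poly_op \<phi> (pCons c p) v = scale c v + poly_op \<phi> p (\<phi> v)"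
proof -
  have "poly_op \<phi> (pCons c p) v
      = (\<Sum>j\<le>Suc (degree p). scale (coeff (pCons c p) j) ((\<phi> ^^ j) v))"
    by (rule poly_op_eq) (simp add: degree_pCons_le)
  also have "\<dots> = scale c v + poly_op \<phi> p (\<phi> v)"
    unfolding sum.atMost_Suc_shift poly_op_def by (simp add: funpow_swap1)
  finally show ?thesis .
qed

lemma poly_op_add: "poly_op \<phi> (p + q) v = poly_op \<phi> p v + poly_op \<phi> q v"
  by (induction p q arbitrary: v rule: poly_induct2)
    (simp_all add: poly_op_pCons scale_left_distrib algebra_simps)

lemma poly_op_smult: "poly_op \<phi> (smult c p) v = scale c (poly_op \<phi> p v)"
  by (induction p arbitrary: v) (simp_all add: poly_op_pCons scale_right_distrib)

lemma endo_poly_op: "endo \<phi> \<Longrightarrow> endo (poly_op \<phi> p)"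
  by (induction p) (simp_all add: endo_iff poly_op_pCons scale_right_distrib algebra_simps)

lemma poly_op_commute: "endo \<phi> \<Longrightarrow> \<phi> (poly_op \<phi> p v) = poly_op \<phi> p (\<phi> v)"
  by (induction p arbitrary: v) (simp_all add: poly_op_pCons endo_0 endo_add endo_scale)

lemma poly_op_mult: "endo \<phi> \<Longrightarrow> poly_op \<phi> (p * q) v = poly_op \<phi> p (poly_op \<phi> q v)"
  by (induction p arbitrary: v)
    (simp_all add: poly_op_pCons poly_op_add poly_op_smult poly_op_commute)

lemma poly_op_invariant:
  assumes "subspace W" "\<And>w. w \<in> W \<Longrightarrow> \<phi> w \<in> W" "w \<in> W"
  shows "poly_op \<phi> p w \<in> W"
  using assms(3)
proof (induction p arbitrary: w)
  case 0
  then show ?case using subspace_0[OF assms(1)] by simp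
next
  case (pCons c p)
  then show ?case unfolding poly_op_pCons
    by (intro subspace_add[OF assms(1)] subspace_scale[OF assms(1)] assms(2) pCons)
qed

end

sublocale finite_dimensional_vector_space \<subseteq> operator_space ..

section \<open>Annihilating polynomials and eigenvectors\<close>

lemma (in finite_dimensional_vector_space) local_annihilator:
  "\<exists>p. p \<noteq> 0 \<and> poly_op \<phi> p v = 0"
proof -
  define f where "f = (\<lambda>j. (\<phi> ^^ j) v)"
  \<comment> \<open>\<open>{..n}\<close> has one index more than the dimension, so the iterates
    satisfy a linear relation.\<close>
  define n where "n = dim UNIV"
  obtain c where c: "\<exists>j\<le>n. c j \<noteq> 0" "(\<Sum>j\<le>n. scale (c j) (f j)) = 0"
  proof (cases "inj_on f {..n}")
    case True
    have "card (f ` {..n}) = Suc n" using True by (simp add: card_image)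
    then have "dependent (f ` {..n})"
      using independent_card_le_dim[of "f ` {..n}" UNIV] unfolding n_def by auto
    then obtain u where u: "\<exists>w\<in>f ` {..n}. u w \<noteq> 0" "(\<Sum>w\<in>f ` {..n}. scale (u w) w) = 0"
      by (auto simp: dependent_finite)
    show thesis
    proof (rule that[of "\<lambda>j. u (f j)"])
      show "(\<Sum>j\<le>n. scale (u (f j)) (f j)) = 0" using u(2) True by (simp add: sum.reindex)
    qed (use u(1) in auto)
  next
    \<comment> \<open>With a repetition the set of iterates is too small for the dimension count,
      but \<open>f i - f j = 0\<close> is itself a relation.\<close>
    case False
    then obtain i j where ij: "i \<le> n" "j \<le> n" "i \<noteq> j" "f i = f j" unfolding inj_on_def by auto
    show thesis
    proof (rule that[of "\<lambda>k. if k = i then 1 else if k = j then -1 else 0"])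
      have "(\<Sum>k\<le>n. scale (if k = i then 1 else if k = j then - 1 else 0) (f k))
          = (\<Sum>k\<in>{i, j}. scale (if k = i then 1 else if k = j then - 1 else 0) (f k))"
        using ij by (intro sum.mono_neutral_right) auto
      then show "(\<Sum>k\<le>n. scale (if k = i then 1 else if k = j then - 1 else 0) (f k)) = 0"
        using ij by simp
    qed (use ij in auto)
  qed
  define p where "p = (\<Sum>j\<le>n. monom (c j) j)"
  have co: "coeff p k = (if k \<le> n then c k else 0)" for k
    unfolding p_def coeff_sum by (simp add: sum.delta)
  have "p \<noteq> 0" using c(1) co by (metis coeff_0)
  moreover have "degree p \<le> n" by (rule degree_le) (simp add: co)
  then have "poly_op \<phi> p v = 0" using c(2) by (simp add: poly_op_eq[of p n] co f_def)
  ultimately show ?thesis by blast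
qed

text \<open>Multiply the local annihilators of the basis vectors; for each basis vector its own
  factor can be made to act first.\<close>

lemma (in finite_dimensional_vector_space) annihilating_poly:
  assumes "endo \<phi>"
  obtains p where "p \<noteq> 0" "\<And>v. poly_op \<phi> p v = 0"
proof -
  obtain q where q: "\<And>v. q v \<noteq> 0" "\<And>v. poly_op \<phi> (q v) v = 0"
    using local_annihilator by metis
  define p where "p = (\<Prod>b\<in>Basis. q b)"
  have 0: "poly_op \<phi> p b = 0" if b: "b \<in> Basis" for b
  proof -
    have "p = (\<Prod>b\<in>Basis - {b}. q b) * q b"
      unfolding p_def using b finite_Basis by (simp add: prod.remove mult.commute)
    then show ?thesis
      using q endo_poly_op[OF assms] by (simp add: poly_op_mult[OF assms] endo_0)
  qed
  note lin = endo_poly_op[OF assms, of p]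
  have "v \<in> span Basis \<Longrightarrow> poly_op \<phi> p v = 0" for v
    by (induction v rule: span_induct_alt)
      (simp_all add: endo_0[OF lin] endo_add[OF lin] endo_scale[OF lin] 0)
  then have "poly_op \<phi> p v = 0" for v by (simp add: span_Basis)
  moreover have "p \<noteq> 0" unfolding p_def using q finite_Basis by simp
  ultimately show thesis using that by blast
qed

text \<open>Split off a root, \<open>p = [:-a, 1:] * q\<close>: either \<open>q\<close> already
  annihilates \<open>w\<close>, or \<open>poly_op \<phi> q w\<close> is an eigenvector for
  \<open>a\<close>.\<close>

lemma eigenvector_in_invariant_subspace:
  fixes scale :: "'a::alg_closed_field \<Rightarrow> 'b::ab_group_add \<Rightarrow> 'b"
  assumes "operator_space scale" "operator_space.endo scale \<phi>"
    and W: "module.subspace scale W" "\<And>w. w \<in> W \<Longrightarrow> \<phi> w \<in> W" "w \<in> W" "w \<noteq> 0"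
    and p: "p \<noteq> 0" "operator_space.poly_op scale \<phi> p w = 0"
  shows "\<exists>a v. v \<in> W \<and> v \<noteq> 0 \<and> \<phi> v = scale a v \<and> poly p a = 0"
proof -
  interpret operator_space scale by fact
  show ?thesis using p
  proof (induction "degree p" arbitrary: p rule: less_induct)
    case less
    show ?case
    proof (cases "degree p = 0")
      case True
      then obtain c where "p = [:c:]" by (metis degree_eq_zeroE)
      then show ?thesis using less.prems W by (simp add: poly_op_pCons)
    next
      case False
      then obtain a where a: "poly p a = 0" using alg_closed_imp_poly_has_root[of p] by auto
      then obtain q where q: "p = [:-a, 1:] * q" by (metis dvd_def poly_eq_0_iff_dvd)
      then have q0: "q \<noteq> 0" using less.prems by auto
      then have "degree q < degree p" unfolding q by (subst degree_mult_eq) auto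
      note IH = less.hyps[OF this q0]
      show ?thesis
      proof (cases "poly_op \<phi> q w = 0")
        case True
        then show ?thesis using IH by (metis poly_mult q mult_zero_right)
      next
        case False
        have "scale (- a) (poly_op \<phi> q w) + \<phi> (poly_op \<phi> q w) = 0"
          using less.prems(2) unfolding q poly_op_mult[OF assms(2)] by (simp add: poly_op_pCons)
        then have "\<phi> (poly_op \<phi> q w) = scale a (poly_op \<phi> q w)"
          by (simp add: eq_neg_iff_add_eq_0 add.commute scale_minus_left)
        then show ?thesis using False a poly_op_invariant[of W \<phi> w q] W by blast
      qed
    qed
  qed
qed

section \<open>Power sums of eigenvalues on coordinate spaces\<close>

definition kronecker :: "'i \<Rightarrow> 'i \<Rightarrow> 'a::zero_neq_one" where
  "kronecker i = (\<lambda>j. if j = i then 1 else 0)"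

text \<open>Stands for the coordinate space on \<open>I\<close>: removing an index lowers the
  dimension without a change of type.\<close>

definition supported :: "'i set \<Rightarrow> ('i \<Rightarrow> 'a::zero) set" where
  "supported I = {w. \<forall>i. i \<notin> I \<longrightarrow> w i = 0}"

definition fun_scale :: "'a::field \<Rightarrow> ('i \<Rightarrow> 'a) \<Rightarrow> 'i \<Rightarrow> 'a" where
  "fun_scale c w = (\<lambda>i. c * w i)"

lemma fun_scale_apply [simp]: "fun_scale c w i = c * w i"
  by (simp add: fun_scale_def)

lemma operator_space_fun: "operator_space fun_scale"
  by standard (auto simp: fun_eq_iff algebra_simps)

lemma subspace_supported: "module.subspace fun_scale (supported I)"
proof -
  interpret operator_space fun_scale by (rule operator_space_fun)
  show ?thesis unfolding subspace_def by (auto simp: supported_def)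
qed

lemma sum_apply: "sum f S x = (\<Sum>i\<in>S. f i x)"
  by (induction S rule: infinite_finite_induct) simp_all

lemma supported_expansion:
  assumes "finite I" "w \<in> supported I"
  shows "w = (\<Sum>i\<in>I. fun_scale (w i) (kronecker i))"
proof
  fix j
  have "(\<Sum>i\<in>I. fun_scale (w i) (kronecker i)) j = (\<Sum>i\<in>I. if i = j then w i else 0)"
    by (subst sum_apply) (auto simp: kronecker_def intro: sum.cong)
  then show "w j = (\<Sum>i\<in>I. fun_scale (w i) (kronecker i)) j"
    using assms by (auto simp: supported_def)
qed

text \<open>Split off an eigenvector \<open>v\<close> with \<open>v o' = 1\<close>: the projection \<open>\<pi>\<close> along \<open>v\<close> onto the functions
  vanishing at \<open>o'\<close> realises the operator induced on the quotient by \<open>v\<close>.\<close>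

lemma eigenvalue_power_sums:
  fixes A :: "('i \<Rightarrow> 'a::alg_closed_field) \<Rightarrow> 'i \<Rightarrow> 'a"
  assumes "finite I" "operator_space.endo fun_scale A"
    and "\<And>w. w \<in> supported I \<Longrightarrow> A w \<in> supported I"
    and "p \<noteq> 0" "\<And>w. w \<in> supported I \<Longrightarrow> operator_space.poly_op fun_scale A p w = 0"
  shows "\<exists>ls. (\<forall>j. (\<Sum>i\<in>I. (A ^^ j) (kronecker i) i) = (\<Sum>l\<leftarrow>ls. l ^ j)) \<and>
    (\<forall>l\<in>set ls. poly p l = 0) \<and>
    (set ls \<subseteq> {0} \<longrightarrow> (\<exists>N. \<forall>w\<in>supported I. (A ^^ N) w = 0))"
  using assms
proof (induction "card I" arbitrary: I A)
  case 0
  then have "I = {}" by simp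
  then have "\<exists>N. \<forall>w\<in>supported I. (A ^^ N) w = 0"
    by (intro exI[of _ 0]) (auto simp: supported_def fun_eq_iff)
  then show ?case
    by (intro exI[of _ "[]"] conjI impI) (simp_all only: \<open>I = {}\<close> list.map list.set sum_list.Nil sum.empty ball_empty simp_thms)
next
  case (Suc n)
  interpret operator_space "fun_scale :: 'a \<Rightarrow> ('i \<Rightarrow> 'a) \<Rightarrow> 'i \<Rightarrow> 'a" by (rule operator_space_fun)
  note fin = Suc.prems(1) and lin = Suc.prems(2) and inv = Suc.prems(3)
  obtain i where i: "i \<in> I" using Suc.hyps(2) by fastforce
  have k0: "kronecker i \<in> supported I" "kronecker i \<noteq> (0 :: 'i \<Rightarrow> 'a)"
    using i by (auto simp: supported_def kronecker_def fun_eq_iff)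
  obtain a u where u: "u \<in> supported I" "u \<noteq> 0" "A u = fun_scale a u" "poly p a = 0"
    using eigenvector_in_invariant_subspace[OF operator_space_fun lin subspace_supported inv k0
        Suc.prems(4) Suc.prems(5)[OF k0(1)]] by blast
  obtain o' where o': "u o' \<noteq> 0" using u(2) by (auto simp: fun_eq_iff)
  then have oI: "o' \<in> I" using u(1) by (auto simp: supported_def)
  define v where "v = fun_scale (1 / u o') u"
  have v: "v \<in> supported I" "v o' = 1" "A v = fun_scale a v"
    using u o' endo_scale[OF lin, of "1 / u o'" u]
    by (auto simp: v_def supported_def fun_eq_iff)
  have Av: "(A ^^ j) v = fun_scale (a ^ j) v" for j
  proof (induction j)
    case 0
    show ?case by (simp add: fun_eq_iff)
  next
    case (Suc j)
    have "(A ^^ Suc j) v = fun_scale (a ^ j) (fun_scale a v)"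
      unfolding funpow.simps o_apply Suc endo_scale[OF lin] v(3) ..
    then show ?case by (simp add: fun_eq_iff)
  qed
  define \<pi> where "\<pi> w = w - fun_scale (w o') v" for w :: "'i \<Rightarrow> 'a"
  have lpi: "endo \<pi>" by (auto simp: endo_iff \<pi>_def fun_eq_iff algebra_simps)
  have piv: "\<pi> v = 0" using v by (auto simp: \<pi>_def fun_eq_iff)
  \<comment> \<open>\<open>\<pi>\<close> kills \<open>v\<close>, and \<open>A v\<close> is a
    multiple of \<open>v\<close>. Hence powers of \<open>?A\<close> will be projections of powers of
    \<open>A\<close>.\<close>
  have Api: "\<pi> (A (\<pi> w)) = \<pi> (A w)" for w
    unfolding \<pi>_def[of w] endo_diff[OF lin] endo_diff[OF lpi] endo_scale[OF lin] v(3)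
      endo_scale[OF lpi] piv by simp
  let ?I = "I - {o'}" and ?A = "\<lambda>w. \<pi> (A w)"
  have pisupp: "\<pi> w \<in> supported ?I" if "w \<in> supported I" for w
    using that v by (auto simp: \<pi>_def supported_def)
  have pifix: "\<pi> w = w" if "w \<in> supported ?I" for w
    using that by (auto simp: \<pi>_def supported_def fun_eq_iff)
  have sub: "w \<in> supported I" if "w \<in> supported ?I" for w :: "'i \<Rightarrow> 'a"
    using that by (auto simp: supported_def)
  have pow: "(?A ^^ j) w = \<pi> ((A ^^ j) w)" if "w \<in> supported ?I" for j w
    using pifix[OF that] by (induction j) (auto simp: Api)
  have "poly_op ?A p w = \<pi> (poly_op A p w)" if "w \<in> supported ?I" for w
    unfolding poly_op_def endo_sum[OF lpi] endo_scale[OF lpi] pow[OF that] ..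
  then have ann: "poly_op ?A p w = 0" if "w \<in> supported ?I" for w
    using that Suc.prems(5)[OF sub[OF that]] endo_0[OF lpi] by simp
  have "n = card ?I" using Suc.hyps(2) oI fin by simp
  note IH = Suc.hyps(1)[OF this _ endo_comp[OF lpi lin] _ Suc.prems(4) ann]
  have "finite ?I" "\<And>w. w \<in> supported ?I \<Longrightarrow> ?A w \<in> supported ?I"
    using fin pisupp inv sub by blast+
  from IH[OF this] obtain ls where ls: "\<And>j. (\<Sum>i\<in>?I. (?A ^^ j) (kronecker i) i) = (\<Sum>l\<leftarrow>ls. l ^ j)"
    "\<And>l. l \<in> set ls \<Longrightarrow> poly p l = 0"
    "set ls \<subseteq> {0} \<Longrightarrow> \<exists>N. \<forall>w\<in>supported ?I. (?A ^^ N) w = 0" by blast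
  have tr: "(\<Sum>i\<in>I. (A ^^ j) (kronecker i) i) = a ^ j + (\<Sum>l\<leftarrow>ls. l ^ j)" for j
  proof -
    have "(\<Sum>i\<in>?I. (?A ^^ j) (kronecker i) i)
        = (\<Sum>i\<in>?I. (A ^^ j) (kronecker i) i - (A ^^ j) (kronecker i) o' * v i)"
    proof (rule sum.cong[OF refl])
      fix k assume "k \<in> ?I"
      then have "kronecker k \<in> supported ?I" by (auto simp: supported_def kronecker_def)
      from pow[OF this, of j]
      show "(?A ^^ j) (kronecker k) k = (A ^^ j) (kronecker k) k - (A ^^ j) (kronecker k) o' * v k"
        by (simp add: \<pi>_def)
    qed
    \<comment> \<open>The summand at \<open>o'\<close> vanishes because
      \<open>v o' = 1\<close>.\<close>
    also have "\<dots> = (\<Sum>i\<in>I. (A ^^ j) (kronecker i) i - (A ^^ j) (kronecker i) o' * v i)"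
      using fin oI v(2) by (simp add: sum.remove[of I o'])
    also have "\<dots> = (\<Sum>i\<in>I. (A ^^ j) (kronecker i) i) - (\<Sum>i\<in>I. fun_scale (v i) ((A ^^ j) (kronecker i))) o'"
      by (simp add: sum_subtractf mult.commute sum_apply)
    also have "(\<Sum>i\<in>I. fun_scale (v i) ((A ^^ j) (kronecker i))) = (A ^^ j) v"
      using arg_cong[OF supported_expansion[OF fin v(1)], of "A ^^ j"]
      by (simp only: endo_sum[OF endo_funpow[OF lin]] endo_scale[OF endo_funpow[OF lin]])
    also have "(A ^^ j) v o' = a ^ j" using v(2) by (simp add: Av)
    finally show ?thesis using ls(1) by simp
  qed
  have nil: "\<exists>N. \<forall>w\<in>supported I. (A ^^ N) w = 0" if 0: "set (a # ls) \<subseteq> {0}"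
  proof -
    obtain N where N: "\<And>w. w \<in> supported ?I \<Longrightarrow> (?A ^^ N) w = 0" using ls(3) 0 by auto
    have "(A ^^ Suc N) w = 0" if w: "w \<in> supported I" for w
    proof -
      have "A v = 0" using v(3) 0 by (auto simp: fun_eq_iff)
      have w': "\<pi> w \<in> supported ?I" using pisupp w by blast
      have "\<pi> ((A ^^ N) (\<pi> w)) = 0" using N[OF w'] pow[OF w'] by simp
      \<comment> \<open>After \<open>N\<close> steps the vector lies on the line of
        \<open>v\<close>, which one more application of \<open>A\<close> kills.\<close>
      then obtain c where c: "(A ^^ N) (\<pi> w) = fun_scale c v" by (auto simp: \<pi>_def)
      have 1: "(A ^^ Suc N) (\<pi> w) = 0"
        unfolding funpow.simps o_apply c endo_scale[OF lin] \<open>A v = 0\<close> by (rule scale_zero_right)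
      have 2: "(A ^^ Suc N) (fun_scale (w o') v) = 0"
        using 0 unfolding endo_scale[OF endo_funpow[OF lin]] Av by simp
      have "(A ^^ Suc N) w = (A ^^ Suc N) (\<pi> w + fun_scale (w o') v)" by (simp add: \<pi>_def)
      also have "\<dots> = 0" unfolding endo_add[OF endo_funpow[OF lin]] 1 2 by (rule add_0)
      finally show ?thesis .
    qed
    then show ?thesis by blast
  qed
  show ?case using tr ls(2) u(4) nil by (intro exI[of _ "a # ls"]) auto
qed

section \<open>The trace form and Cartan's nilpotency criterion\<close>

text \<open>One exponent for all roots suits the interpolation; it exceeds every multiplicity, as
  these are at most the degree.\<close>

lemma splits_dvd_linear_powers:
  fixes p :: "'a::alg_closed_field poly"
  assumes "p \<noteq> 0"
  obtains S where "finite S" "\<And>a. poly p a = 0 \<Longrightarrow> a \<in> S" "p dvd (\<Prod>a\<in>S. [:-a, 1:] ^ Suc (degree p))"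
proof -
  obtain M where M: "size M = degree p" "p = smult (lead_coeff p) (\<Prod>x\<in>#M. [:-x, 1:])"
    using alg_closed_imp_factorization[OF assms] by blast
  let ?q = "\<Prod>a\<in>set_mset M. [:-a, 1:] ^ Suc (degree p)"
  have "(\<Prod>x\<in>#M. [:-x, 1:]) = (\<Prod>a\<in>set_mset M. [:-a, 1:] ^ count M a)"
    by (rule image_prod_mset_multiplicity)
  also have "\<dots> dvd ?q"
  proof (intro prod_dvd_prod le_imp_power_dvd)
    fix a show "count M a \<le> Suc (degree p)" using count_le_size[of M a] M(1) by simp
  qed
  finally have "p dvd ?q"
    using assms M(2) smult_dvd_iff[of "lead_coeff p" "\<Prod>x\<in>#M. [:-x, 1:]" ?q] by simp
  moreover have "a \<in> set_mset M" if "poly p a = 0" for a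
  proof -
    have "poly ?q a = 0" using that \<open>p dvd ?q\<close> by (metis dvdE mult_zero_left poly_mult)
    then show ?thesis by (auto simp: poly_prod)
  qed
  ultimately show thesis using that by blast
qed

text \<open>The field is a vector space over the rationals, so a value can be prescribed on the
  independent set \<open>{l}\<close> and extended linearly.\<close>

lemma rational_functional:
  fixes l :: "'a::field_char_0"
  assumes "l \<noteq> 0"
  obtains f :: "'a \<Rightarrow> rat" where
    "\<And>x y. f (x + y) = f x + f y" "\<And>r x. f (of_rat r * x) = r * f x" "f l = 1"
proof -
  interpret vector_space_pair "\<lambda>r (x :: 'a). of_rat r * x" "(*) :: rat \<Rightarrow> rat \<Rightarrow> rat"
    by unfold_locales (auto simp: algebra_simps of_rat_add of_rat_mult)
  have "vs1.independent {l}" using assms by simp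
  from linear_independent_extend[OF this, of "\<lambda>_. 1"]
  obtain f where f: "Vector_Spaces.linear (\<lambda>r (x :: 'a). of_rat r * x) (*) f" "f l = 1" by auto
  show thesis
    by (rule that[of f]) (use f in \<open>simp_all add: Vector_Spaces.linear_def module_hom_iff\<close>)
qed

text \<open>For a nonzero member \<open>l\<close> choose a rational-linear \<open>f\<close> with
  \<open>f l = 1\<close>; applying \<open>f\<close> to the vanishing sum gives a vanishing sum of
  rational squares, one of which is 1.\<close>

lemma power_sums_rational_functionals:
  fixes ls :: "'a::field_char_0 list"
  assumes "\<And>f :: 'a \<Rightarrow> rat. (\<And>x y. f (x + y) = f x + f y) \<Longrightarrow> (\<Sum>l\<leftarrow>ls. l * of_rat (f l)) = 0"
  shows "set ls \<subseteq> {0}"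
proof
  fix l assume l: "l \<in> set ls"
  show "l \<in> {0}"
  proof (rule ccontr)
    assume "l \<notin> {0}"
    then have "l \<noteq> 0" by simp
    then obtain f :: "'a \<Rightarrow> rat" where
      f: "\<And>x y. f (x + y) = f x + f y" "\<And>r x. f (of_rat r * x) = r * f x" "f l = 1"
      by (rule rational_functional) blast
    have f0: "f 0 = 0" using f(2)[of 0 0] by simp
    have "f (\<Sum>l\<leftarrow>ks. l * of_rat (f l)) = (\<Sum>l\<leftarrow>ks. f l * f l)" for ks
      by (induction ks) (auto simp: f f0 mult.commute[of _ "of_rat _"])
    then have "(\<Sum>l\<leftarrow>ls. f l * f l) = 0" using assms[OF f(1)] f0 by metis
    then have "f l * f l = 0" using l by (subst (asm) sum_list_nonneg_eq_0_iff) auto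
    then show False using f(3) by simp
  qed
qed

section \<open>Traces with respect to the fixed basis\<close>

context finite_dimensional_vector_space
begin

definition op_trace :: "('b \<Rightarrow> 'b) \<Rightarrow> 'a" where
  "op_trace h = (\<Sum>b\<in>Basis. representation Basis (h b) b)"

lemma in_span_Basis [simp]: "v \<in> span Basis"
  by (simp add: span_Basis)

lemma basis_expansion: "v = (\<Sum>b\<in>Basis. scale (representation Basis v b) b)"
  by (rule sum_representation_eq[symmetric]) (simp_all add: independent_Basis finite_Basis)

lemma op_trace_add: "op_trace (\<lambda>v. f v + g v) = op_trace f + op_trace g"
  by (simp add: op_trace_def representation_add independent_Basis sum.distrib)

lemma op_trace_scale: "op_trace (\<lambda>v. scale c (f v)) = c * op_trace f"
  by (simp add: op_trace_def representation_scale independent_Basis sum_distrib_left)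

lemma op_trace_0 [simp]: "op_trace (\<lambda>v. 0) = 0"
  using op_trace_scale[of 0 "\<lambda>v. 0"] by simp

lemma op_trace_diff: "op_trace (\<lambda>v. f v - g v) = op_trace f - op_trace g"
  using op_trace_add[of "\<lambda>v. f v - g v" g] by simp

lemma op_trace_sum: "op_trace (\<lambda>v. \<Sum>i\<in>S. f i v) = (\<Sum>i\<in>S. op_trace (f i))"
  by (induction S rule: infinite_finite_induct) (simp_all add: op_trace_add)

lemma representation_sum':
  "representation Basis (\<Sum>i\<in>S. scale (c i) (w i)) b = (\<Sum>i\<in>S. c i * representation Basis (w i) b)"
  by (induction S rule: infinite_finite_induct)
    (simp_all add: representation_add representation_scale representation_zero independent_Basis)

text \<open>The matrix product formula, whose symmetry in the two factors yields
  \<open>op_trace_commute\<close>.\<close>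

lemma op_trace_comp:
  assumes "endo f"
  shows "op_trace (\<lambda>v. f (g v))
    = (\<Sum>b\<in>Basis. \<Sum>c\<in>Basis. representation Basis (g b) c * representation Basis (f c) b)"
  unfolding op_trace_def
proof (rule sum.cong[OF refl])
  fix b
  have "f (g b) = (\<Sum>c\<in>Basis. scale (representation Basis (g b) c) (f c))"
    using arg_cong[OF basis_expansion[of "g b"], of f] by (simp only: endo_sum[OF assms] endo_scale[OF assms])
  then show "representation Basis (f (g b)) b
      = (\<Sum>c\<in>Basis. representation Basis (g b) c * representation Basis (f c) b)"
    by (simp only: representation_sum')
qed

lemma op_trace_commute:
  assumes "endo f" "endo g"
  shows "op_trace (\<lambda>v. f (g v)) = op_trace (\<lambda>v. g (f v))"
  unfolding op_trace_comp[OF assms(1)] op_trace_comp[OF assms(2)]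
  by (subst sum.swap) (simp add: mult.commute)

lemma op_trace_poly_op:
  assumes "endo h"
  shows "op_trace (\<lambda>v. h (poly_op \<phi> p (u v)))
    = (\<Sum>k\<le>degree p. coeff p k * op_trace (\<lambda>v. h ((\<phi> ^^ k) (u v))))"
  unfolding poly_op_def endo_sum[OF assms] endo_scale[OF assms] op_trace_sum op_trace_scale ..

lemma umbral_op_trace:
  assumes "endo h"
  shows "umbral (\<lambda>k. to_ac (op_trace (\<lambda>v. h ((\<phi> ^^ k) (u v))))) (map_poly to_ac p)
    = to_ac (op_trace (\<lambda>v. h (poly_op \<phi> p (u v))))"
proof -
  have "degree (map_poly to_ac p) \<le> degree p" by (rule map_poly_degree_leq)
  then show ?thesis
    by (simp add: umbral_eq op_trace_poly_op[OF assms] to_ac_sum coeff_map_poly)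
qed

text \<open>Extension of scalars to the algebraic closure, where
  \<open>eigenvalue_power_sums\<close> applies; \<open>ls\<close> serves as the list of eigenvalues
  with multiplicity.\<close>

lemma operator_power_traces:
  assumes \<phi>: "endo \<phi>" and p: "p \<noteq> 0" "\<And>v. poly_op \<phi> p v = 0"
  obtains ls where "\<And>j. to_ac (op_trace (\<phi> ^^ j)) = (\<Sum>l\<leftarrow>ls. l ^ j)"
    "\<And>l. l \<in> set ls \<Longrightarrow> poly (map_poly to_ac p) l = 0"
    "set ls \<subseteq> {0} \<Longrightarrow> \<exists>N. \<forall>v. (\<phi> ^^ N) v = 0"
proof -
  interpret K: operator_space "fun_scale :: 'a alg_closure \<Rightarrow> ('b \<Rightarrow> 'a alg_closure) \<Rightarrow> _"
    by (rule operator_space_fun)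
  \<comment> \<open>\<open>E\<close> embeds a vector through its coordinates, and \<open>A\<close>
    is the scalar extension of \<open>\<phi>\<close> to functions on \<open>Basis\<close>.\<close>
  define E where "E v = (\<lambda>i. to_ac (representation Basis v i))" for v
  define A where "A w = (\<Sum>b\<in>Basis. fun_scale (w b) (E (\<phi> b)))" for w
  have E_add: "E (x + y) = E x + E y" for x y
    by (simp add: E_def fun_eq_iff representation_add independent_Basis)
  have E_scale: "E (scale c x) = fun_scale (to_ac c) (E x)" for c x
    by (simp add: E_def fun_eq_iff representation_scale independent_Basis)
  have E_0: "E 0 = 0" by (simp add: E_def fun_eq_iff representation_zero)
  have E_sum: "E (sum h S) = (\<Sum>i\<in>S. E (h i))" for h :: "'c \<Rightarrow> 'b" and S
    by (induction S rule: infinite_finite_induct) (simp_all only: sum.infinite sum.empty sum.insert E_0 E_add simp_thms)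
  have E_supp: "E v \<in> supported Basis" for v
    by (auto simp: supported_def E_def dest: representation_ne_zero)
  have E_basis: "E b = kronecker b" if "b \<in> Basis" for b
    using that by (simp add: E_def kronecker_def fun_eq_iff representation_basis independent_Basis)
  have lin: "K.endo A"
    unfolding K.endo_iff A_def
    by (simp add: K.scale_left_distrib sum.distrib K.scale_sum_right plus_fun_apply)
  have AE: "A (E v) = E (\<phi> v)" for v
  proof -
    have "E (\<phi> v) = E (\<phi> (\<Sum>b\<in>Basis. scale (representation Basis v b) b))"
      using basis_expansion[of v] by simp
    also have "\<dots> = A (E v)"
      unfolding endo_sum[OF \<phi>] endo_scale[OF \<phi>] E_sum E_scale A_def by (simp add: E_def)
    finally show ?thesis ..
  qed
  have AjE: "(A ^^ j) (E v) = E ((\<phi> ^^ j) v)" for j v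
    by (induction j) (simp_all add: AE)
  have inv: "A w \<in> supported Basis" for w
    unfolding A_def using E_supp by (auto simp: supported_def sum_apply)
  let ?p = "map_poly to_ac p"
  have p0: "?p \<noteq> 0" using p(1) by (simp add: map_poly_eq_0_iff)
  have "K.poly_op A ?p (E v) = E (poly_op \<phi> p v)" for v
  proof -
    have "degree ?p \<le> degree p" by (rule map_poly_degree_leq)
    then show ?thesis
      unfolding poly_op_def E_sum E_scale by (simp add: K.poly_op_eq AjE coeff_map_poly)
  qed
  then have pE: "K.poly_op A ?p (E v) = 0" for v using p(2) E_0 by simp
  have ann: "K.poly_op A ?p w = 0" if "w \<in> supported Basis" for w
  proof -
    note lp = K.endo_poly_op[OF lin, of ?p]
    have "w = (\<Sum>b\<in>Basis. fun_scale (w b) (E b))"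
      using supported_expansion[OF finite_Basis that] by (simp add: E_basis)
    from arg_cong[OF this, of "K.poly_op A ?p"] show ?thesis
      unfolding K.endo_sum[OF lp] K.endo_scale[OF lp] pE by simp
  qed
  obtain ls where ls: "\<And>j. (\<Sum>i\<in>Basis. (A ^^ j) (kronecker i) i) = (\<Sum>l\<leftarrow>ls. l ^ j)"
    "\<And>l. l \<in> set ls \<Longrightarrow> poly ?p l = 0"
    "set ls \<subseteq> {0} \<Longrightarrow> \<exists>N. \<forall>w\<in>supported Basis. (A ^^ N) w = 0"
    using eigenvalue_power_sums[OF finite_Basis lin inv p0 ann] by blast
  have "to_ac (op_trace (\<phi> ^^ j)) = (\<Sum>l\<leftarrow>ls. l ^ j)" for j
  proof -
    have "(\<Sum>i\<in>Basis. (A ^^ j) (kronecker i) i) = (\<Sum>i\<in>Basis. E ((\<phi> ^^ j) i) i)"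
      by (intro sum.cong refl) (simp add: E_basis[symmetric] AjE)
    then show ?thesis using ls(1) by (simp add: op_trace_def to_ac_sum E_def)
  qed
  moreover have "\<exists>N. \<forall>v. (\<phi> ^^ N) v = 0" if "set ls \<subseteq> {0}"
  proof -
    obtain N where N: "\<And>w. w \<in> supported Basis \<Longrightarrow> (A ^^ N) w = 0" using ls(3)[OF \<open>set ls \<subseteq> {0}\<close>] by blast
    have "(\<phi> ^^ N) v = 0" for v
    proof -
      have "E ((\<phi> ^^ N) v) = 0" using N[OF E_supp, of v] by (simp add: AjE)
      then have "representation Basis ((\<phi> ^^ N) v) b = 0" for b by (auto simp: E_def fun_eq_iff)
      then show ?thesis using basis_expansion[of "(\<phi> ^^ N) v"] by simp
    qed
    then show ?thesis by blast
  qed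
  ultimately show thesis using that ls(2) by blast
qed

end

section \<open>The trace form and nilpotency of left multiplications\<close>

locale leibniz_algebra_char_0 = leibniz_algebra scale Basis bracket
  for scale :: "'a::field_char_0 \<Rightarrow> 'b::ab_group_add \<Rightarrow> 'b" and Basis bracket
begin

definition trace_form :: "'b \<Rightarrow> 'b \<Rightarrow> 'a" where
  "trace_form x y = op_trace (\<lambda>v. bracket x (bracket y v))"

definition trace_radical :: "'b set" where
  "trace_radical = {x. \<forall>y. trace_form x y = 0}"

lemma endo_bracket: "endo (bracket x)"
  by (simp add: endo_iff bracket_add_right bracket_scale_right)

lemma bracket_diff_right: "bracket x (y - z) = bracket x y - bracket x z"
  by (rule endo_diff[OF endo_bracket])

lemma bracket_bracket_left: "bracket (bracket x y) z = bracket x (bracket y z) - bracket y (bracket x z)"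
  using left_leibniz[of x y z] by (simp only: add_diff_cancel_right')

text \<open>With \<open>L_x\<close> for \<open>bracket x\<close>, this says
  \<open>tr(L_[a,b] g(L_x)) = 0\<close>. By cyclicity the trace equals that of
  \<open>L_a [L_b, g(L_x)]\<close>; the replica expresses the commutator by the operators
  \<open>L_(y k)\<close> below, and \<open>tr(L_a L_(y k)) = 0\<close> because \<open>a\<close> lies
  in the radical.\<close>

lemma replica_trace:
  fixes f :: "'a alg_closure \<Rightarrow> 'a alg_closure" and S n
  assumes S: "finite S" and f: "\<And>x y. f (x - y) = f x - f y"
    and g: "\<And>a. a \<in> S \<Longrightarrow> [:-a, 1:] ^ n dvd g - [:f a:]"
    and p: "\<And>v. poly_op (bracket x) p v = 0" "map_poly to_ac p dvd (\<Prod>a\<in>S. [:-a, 1:] ^ n)"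
    and a: "a \<in> trace_radical"
  shows "umbral (\<lambda>k. to_ac (op_trace (\<lambda>v. bracket (bracket a b) ((bracket x ^^ k) v)))) g = 0"
proof -
  \<comment> \<open>\<open>L_(y (Suc k))\<close> is the commutator of \<open>L_(y k)\<close> with
    \<open>L_x\<close>, that is, one more application of \<open>ad L_x\<close> up to sign.\<close>
  define y where "y k = ((\<lambda>z. bracket z x) ^^ k) b" for k
  have y0: "y 0 = b" and ySuc: "y (Suc k) = bracket (y k) x" for k by (simp_all add: y_def)
  \<comment> \<open>\<open>i\<close> counts the factors \<open>L_x\<close> applied before
    \<open>L_(y k)\<close>, and \<open>j\<close> those applied after it.\<close>
  define w where "w k i j
    = to_ac (op_trace (\<lambda>v. bracket a ((bracket x ^^ j) (bracket (y k) ((bracket x ^^ i) v)))))" for k i j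
  note pow = endo_funpow[OF endo_bracket, of _ x]
  have w1: "w (Suc k) i j = w k (Suc i) j - w k i (Suc j)" for k i j
    unfolding w_def ySuc bracket_bracket_left endo_diff[OF pow] bracket_diff_right op_trace_diff to_ac_diff
    by (simp add: funpow_swap1)
  have w2: "w k 0 0 = 0" for k
    using a by (simp add: w_def trace_radical_def trace_form_def)
  have p1: "umbral (\<lambda>k. w 0 (i + k) j) (map_poly to_ac p) = 0" for i j
  proof -
    have "endo (\<lambda>z. bracket a ((bracket x ^^ j) (bracket b z)))"
      by (rule endo_comp[OF endo_bracket endo_comp[OF pow endo_bracket]])
    from umbral_op_trace[OF this, of "bracket x" "bracket x ^^ i" p] show ?thesis
      unfolding w_def y0 p(1) add.commute[of i] funpow_add o_apply
      by (simp add: endo_0[OF pow])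
  qed
  have p2: "umbral (\<lambda>k. w 0 i (j + k)) (map_poly to_ac p) = 0" for i j
  proof -
    have "endo (\<lambda>z. bracket a ((bracket x ^^ j) z))"
      by (rule endo_comp[OF endo_bracket pow])
    from umbral_op_trace[OF this, of "bracket x" "\<lambda>v. bracket b ((bracket x ^^ i) v)" p] show ?thesis
      unfolding w_def y0 p(1) funpow_add o_apply by (simp add: endo_0[OF pow])
  qed
  have "w 0 k 0 - w 0 0 k = to_ac (op_trace (\<lambda>v. bracket (bracket a b) ((bracket x ^^ k) v)))" for k
  proof -
    have "op_trace (\<lambda>v. bracket a ((bracket x ^^ k) (bracket b v)))
        = op_trace (\<lambda>v. bracket b (bracket a ((bracket x ^^ k) v)))"
      by (rule op_trace_commute[of "\<lambda>z. bracket a ((bracket x ^^ k) z)" "bracket b"])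
        (rule endo_comp[OF endo_bracket pow] endo_bracket)+
    then show ?thesis
      unfolding w_def y0 bracket_bracket_left op_trace_diff to_ac_diff by simp
  qed
  then show ?thesis
    using replica_annihilates[OF S f g w1 w2 p(2) p1 p2] by simp
qed

lemma cartan_nilpotent:
  assumes x: "x \<in> bracket_span trace_radical UNIV"
  shows "\<exists>N. \<forall>v. (bracket x ^^ N) v = 0"
proof -
  obtain p where p: "p \<noteq> 0" "\<And>v. poly_op (bracket x) p v = 0"
    using annihilating_poly[OF endo_bracket] by metis
  obtain ls where ls: "\<And>j. to_ac (op_trace (bracket x ^^ j)) = (\<Sum>l\<leftarrow>ls. l ^ j)"
    "\<And>l. l \<in> set ls \<Longrightarrow> poly (map_poly to_ac p) l = 0"
    "set ls \<subseteq> {0} \<Longrightarrow> \<exists>N. \<forall>v. (bracket x ^^ N) v = 0"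
    using operator_power_traces[OF endo_bracket p] by metis
  define P where "P = map_poly to_ac p"
  have "P \<noteq> 0" using p(1) by (simp add: P_def map_poly_eq_0_iff)
  from splits_dvd_linear_powers[OF this]
  obtain S where S: "finite S" "\<And>a. poly P a = 0 \<Longrightarrow> a \<in> S"
    "P dvd (\<Prod>a\<in>S. [:-a, 1:] ^ Suc (degree P))" by metis
  have S3: "map_poly to_ac p dvd (\<Prod>a\<in>S. [:-a, 1:] ^ Suc (degree P))"
    using S(3) by (simp add: P_def)
  have "(\<Sum>l\<leftarrow>ls. l * of_rat (f l)) = 0" if f: "\<And>x y. f (x + y) = f x + f y" for f :: "'a alg_closure \<Rightarrow> rat"
  proof -
    let ?f = "\<lambda>z. of_rat (f z) :: 'a alg_closure"
    have "f (u - v) = f u - f v" for u v using f[of "u - v" v] by simp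
    then have f': "?f (u - v) = ?f u - ?f v" for u v by (simp add: of_rat_diff)
    obtain g where g: "\<And>a. a \<in> S \<Longrightarrow> [:-a, 1:] ^ Suc (degree P) dvd g - [:?f a:]"
      using linear_powers_interpolation[OF S(1), of "Suc (degree P)" ?f] by metis
    \<comment> \<open>\<open>G z\<close> stands for \<open>tr(L_z g(L_x))\<close>. It is linear in
      \<open>z\<close>, so vanishing on the generating brackets carries over to
      \<open>x\<close>.\<close>
    define G where
      "G z = umbral (\<lambda>k. to_ac (op_trace (\<lambda>v. bracket z ((bracket x ^^ k) v)))) g" for z
    have "G z = 0" if "z \<in> bracket_span trace_radical UNIV" for z
      using that unfolding bracket_span_def
    proof (induction rule: span_induct_alt)
      case base
      show ?case by (simp add: G_def)
    next
      case (step c z z')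
      then obtain a b where ab: "z = bracket a b" "a \<in> trace_radical" by blast
      then have "G z = 0"
        using replica_trace[of S ?f "Suc (degree P)" g x p a b] S(1) f' g p(2) S3
        unfolding G_def by blast
      moreover have "G (scale c z + z') = to_ac c * G z + G z'"
        by (simp add: G_def bracket_add_left bracket_scale_left op_trace_add op_trace_scale
            umbral_add_left umbral_mult_left)
      ultimately show ?case using step by simp
    qed
    \<comment> \<open>For \<open>z = x\<close> the extra \<open>L_x\<close> raises the power to
      \<open>Suc k\<close>, which becomes the factor \<open>l\<close> before
      \<open>poly g l\<close>.\<close>
    from this[OF x] have "umbral (\<lambda>k. to_ac (op_trace (bracket x ^^ Suc k))) g = 0"
      by (simp add: G_def o_def)
    then have 0: "umbral (\<lambda>k. \<Sum>l\<leftarrow>ls. l ^ Suc k) g = 0" by (simp only: ls(1))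
    have "umbral (\<lambda>k. \<Sum>l\<leftarrow>ks. l ^ Suc k) g = (\<Sum>l\<leftarrow>ks. l * poly g l)" for ks
      by (induction ks) (simp_all add: umbral_add_left umbral_power_Suc[simplified])
    with 0 have "(\<Sum>l\<leftarrow>ls. l * poly g l) = 0" by simp
    moreover have "poly g l = ?f l" if "l \<in> set ls" for l
    proof -
      have "l \<in> S" using ls(2)[OF that] S(2) by (simp add: P_def)
      \<comment> \<open>The exponent is a successor, so at least one linear factor divides and
        \<open>g\<close> takes the value \<open>?f l\<close> at \<open>l\<close>.\<close>
      then have "[:-l, 1:] dvd g - [:?f l:]" using g dvd_trans[OF dvd_power] by blast
      then have "poly (g - [:?f l:]) l = 0" by (simp only: poly_eq_0_iff_dvd)
      then show ?thesis by simp
    qed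
    ultimately show ?thesis by (simp cong: map_cong)
  qed
  then show ?thesis using power_sums_rational_functionals ls(3) by blast
qed

end

section \<open>Engel's theorem and completeness\<close>

context leibniz_algebra
begin

lemma dim_psubset: "subspace S \<Longrightarrow> subspace T \<Longrightarrow> S \<subset> T \<Longrightarrow> dim S < dim T"
  using subspace_dim_equal[of S T] dim_subset[of S T] by (metis linorder_not_le psubsetE)

lemma maximal_subspace:
  assumes "P S" "\<And>S. P S \<Longrightarrow> subspace S"
  obtains S where "P S" "\<And>T. P T \<Longrightarrow> \<not> S \<subset> T"
proof -
  have "\<forall>S. P S \<longrightarrow> dim S < Suc (dim UNIV)"
    unfolding less_Suc_eq_le by (intro allI impI dim_subset subset_UNIV)
  then have "\<exists>S. P S \<and> (\<forall>T. P T \<longrightarrow> dim T \<le> dim S)"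
    using assms(1) by (intro ex_has_greatest_nat[of P S dim "Suc (dim UNIV)"]) (auto intro: less_imp_le)
  then obtain S where "P S" "\<And>T. P T \<Longrightarrow> dim T \<le> dim S" by blast
  then show thesis using that dim_psubset assms(2) by (metis linorder_not_le)
qed

definition subalgebra_with_Leib :: "'b set \<Rightarrow> bool" where
  "subalgebra_with_Leib H \<longleftrightarrow> subspace H \<and> Leib \<subseteq> H \<and> (\<forall>x\<in>H. \<forall>y\<in>H. bracket x y \<in> H)"

definition invariant_under :: "'b set \<Rightarrow> 'b set \<Rightarrow> bool" where
  "invariant_under H U \<longleftrightarrow> (\<forall>x\<in>H. \<forall>u\<in>U. bracket x u \<in> U)"

lemma subalgebra_Leib: "subalgebra_with_Leib Leib"
  using subspace_Leib subspace_0[OF subspace_Leib] bracket_Leib_left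
  by (auto simp: subalgebra_with_Leib_def)

lemma mem_span_insert: "subspace S \<Longrightarrow> x \<in> span (insert z S) \<longleftrightarrow> (\<exists>s\<in>S. \<exists>c. x = s + scale c z)"
proof -
  assume S: "subspace S"
  then have "span S = S" by (simp add: span_eq_iff)
  then have "x \<in> span (insert z S) \<longleftrightarrow> (\<exists>c. x - scale c z \<in> S)"
    unfolding span_breakdown_eq[of x z S] by (simp only:)
  also have "\<dots> \<longleftrightarrow> (\<exists>s\<in>S. \<exists>c. x = s + scale c z)"
    by (metis add_diff_cancel_right' diff_add_cancel)
  finally show ?thesis .
qed

lemma subset_span_insert: "S \<subseteq> span (insert z S)" "z \<in> span (insert z S)"
  by (auto intro: span_base)

text \<open>Engel's theorem, relative to a pair \<open>U \<subset> W\<close> of invariant subspaces in place of a quotient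
  module. Keeping \<open>Leib\<close> inside all subalgebras makes the bracket antisymmetric modulo them.\<close>

lemma engel:
  assumes "subalgebra_with_Leib H" "\<And>x. x \<in> H \<Longrightarrow> \<exists>N. \<forall>v. (bracket x ^^ N) v = 0"
    and "subspace U" "subspace W" "U \<subset> W" "invariant_under H U" "invariant_under H W"
  shows "\<exists>w\<in>W - U. \<forall>h\<in>H. bracket h w \<in> U"
  using assms
proof (induction "dim H" arbitrary: H U W rule: less_induct)
  case less
  note H = less.prems(1) and nil = less.prems(2) and U = less.prems(3) and W = less.prems(4,5)
    and inv = less.prems(6,7)
  show ?case
  proof (cases "H = Leib")
    case True
    \<comment> \<open>Elements of \<open>Leib\<close> act as zero from the left, so any vector of
      \<open>W\<close> outside \<open>U\<close> serves.\<close>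
    obtain w where "w \<in> W - U" using W by blast
    then show ?thesis using True bracket_Leib_left subspace_0[OF U] by auto
  next
    case False
    let ?P = "\<lambda>K. subalgebra_with_Leib K \<and> K \<subset> H"
    have "?P Leib" using False H subalgebra_Leib by (auto simp: subalgebra_with_Leib_def)
    then obtain K where K: "?P K" and max: "\<And>T. ?P T \<Longrightarrow> \<not> K \<subset> T"
      by (rule maximal_subspace) (auto simp: subalgebra_with_Leib_def)
    have sK: "subspace K" and LK: "Leib \<subseteq> K" and cK: "\<And>x y. x \<in> K \<Longrightarrow> y \<in> K \<Longrightarrow> bracket x y \<in> K"
      and sH: "subspace H" and cH: "\<And>x y. x \<in> H \<Longrightarrow> y \<in> H \<Longrightarrow> bracket x y \<in> H"
      using K H by (auto simp: subalgebra_with_Leib_def)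
    have dK: "dim K < dim H" using K sK sH by (intro dim_psubset) auto
    have nilK: "\<And>x. x \<in> K \<Longrightarrow> \<exists>N. \<forall>v. (bracket x ^^ N) v = 0" using nil K by auto
    have "invariant_under K K" "invariant_under K H"
      using cK cH K by (auto simp: invariant_under_def)
    \<comment> \<open>First use of the induction hypothesis, for \<open>K\<close> acting on the pair
      \<open>K \<subset> H\<close>: it yields \<open>z\<close> normalising \<open>K\<close>, and
      then \<open>K\<close> and \<open>z\<close> span \<open>H\<close> by maximality.\<close>
    then obtain z where z: "z \<in> H" "z \<notin> K" "\<And>k. k \<in> K \<Longrightarrow> bracket k z \<in> K"
      using less.hyps[OF dK _ nilK sK sH] K by blast
    have zk: "bracket z k \<in> K" if "k \<in> K" for k
      using subspace_diff[OF sK subsetD[OF LK bracket_sym_in_Leib[of z k]] z(3)[OF that]] by simp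
    have zz: "bracket z z \<in> K" using LK square_in_Leib by blast
    let ?M = "span (insert z K)"
    have "bracket x y \<in> ?M" if xM: "x \<in> ?M" and yM: "y \<in> ?M" for x y
    proof -
      obtain k c k' c' where xy: "x = k + scale c z" "y = k' + scale c' z" "k \<in> K" "k' \<in> K"
        using xM yM unfolding mem_span_insert[OF sK] by blast
      have "bracket x y = (bracket k k' + scale c' (bracket k z))
          + (scale c (bracket z k') + scale c' (scale c (bracket z z)))"
        unfolding xy by (simp only: bracket_add_left bracket_add_right bracket_scale_left
            bracket_scale_right scale_right_distrib add_ac)
      also have "\<dots> \<in> K"
        using xy cK z(3) zk zz by (intro subspace_add[OF sK] subspace_scale[OF sK]) auto
      finally show ?thesis using subset_span_insert by blast
    qed
    then have "subalgebra_with_Leib ?M"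
      using subset_trans[OF LK subset_span_insert(1)] by (simp add: subalgebra_with_Leib_def)
    moreover have "?M \<subseteq> H" using z K sH by (intro span_minimal) auto
    moreover have "K \<subset> ?M" using z subset_span_insert by blast
    ultimately have MH: "?M = H" using max[of ?M] by blast
    have "invariant_under K U" "invariant_under K W"
      using inv K by (auto simp: invariant_under_def)
    \<comment> \<open>Second use, for \<open>K\<close> acting on the original pair
      \<open>U \<subset> W\<close>.\<close>
    then obtain w0 where w0: "w0 \<in> W - U" "\<And>k. k \<in> K \<Longrightarrow> bracket k w0 \<in> U"
      using less.hyps[OF dK _ nilK U W] K by blast
    \<comment> \<open>Since \<open>z\<close> normalises \<open>K\<close>, the Leibniz identity shows
      that \<open>z\<close> preserves the vectors of \<open>W\<close> sent into \<open>U\<close> by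
      \<open>K\<close>.\<close>
    have orbit: "(bracket z ^^ j) w0 \<in> W \<and> (\<forall>k\<in>K. bracket k ((bracket z ^^ j) w0) \<in> U)" for j
    proof (induction j)
      case 0
      then show ?case using w0 by simp
    next
      case (Suc j)
      let ?w = "(bracket z ^^ j) w0"
      have "bracket k (bracket z ?w) \<in> U" if "k \<in> K" for k
      proof -
        have "bracket (bracket k z) ?w \<in> U" using Suc z(3) that by blast
        moreover have "bracket z (bracket k ?w) \<in> U"
          using Suc that inv(1) z(1) by (auto simp: invariant_under_def)
        ultimately show ?thesis unfolding left_leibniz[of k z] by (rule subspace_add[OF U])
      qed
      then show ?case using Suc inv(2) z(1) by (auto simp: invariant_under_def)
    qed
    obtain N where "(bracket z ^^ N) w0 = 0" using nil[OF z(1)] by blast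
    then have "\<exists>j. (bracket z ^^ j) w0 \<in> U" using subspace_0[OF U] by metis
    \<comment> \<open>The last iterate outside \<open>U\<close> is the required vector; it exists
      because \<open>w0\<close> is not in \<open>U\<close>.\<close>
    then obtain j where j: "(bracket z ^^ j) w0 \<in> U" "\<And>i. i < j \<Longrightarrow> (bracket z ^^ i) w0 \<notin> U"
      using exists_least_iff[of "\<lambda>j. (bracket z ^^ j) w0 \<in> U"] by blast
    then obtain i where i: "j = Suc i" using w0 by (cases j) auto
    let ?w = "(bracket z ^^ i) w0"
    have w: "?w \<in> W - U" "bracket z ?w \<in> U" using orbit[of i] j i by auto
    have "bracket h ?w \<in> U" if hH: "h \<in> H" for h
    proof -
      obtain k c where h: "h = k + scale c z" "k \<in> K"
        using hH unfolding MH[symmetric] mem_span_insert[OF sK] by blast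
      have "bracket k ?w \<in> U" using orbit h by blast
      then show ?thesis
        unfolding h bracket_add_left bracket_scale_left
        by (intro subspace_add[OF U] subspace_scale[OF U] w(2))
    qed
    then show ?thesis using w by blast
  qed
qed

text \<open>For nonzero \<open>P\<close> take a maximal proper invariant subspace \<open>U\<close>.
  Engel's theorem gives \<open>w\<close> in \<open>P - U\<close> with \<open>[P, w]\<close> inside
  \<open>U\<close>; by maximality \<open>U\<close> and \<open>w\<close> span \<open>P\<close>, so
  \<open>[P, P]\<close> lies in \<open>U\<close>, against perfectness.\<close>

lemma perfect_nilpotent_trivial:
  assumes P: "subspace P" "bracket_span P P = P"
    and nil: "\<And>x. x \<in> P \<Longrightarrow> \<exists>N. \<forall>v. (bracket x ^^ N) v = 0"
  shows "P = {0}"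
proof (rule ccontr)
  assume ne: "P \<noteq> {0}"
  have cP: "bracket x y \<in> P" if "x \<in> P" "y \<in> P" for x y
  proof -
    have "bracket x y \<in> bracket_span P P"
      unfolding bracket_span_def using that by (intro span_base) blast
    then show ?thesis using P(2) by simp
  qed
  \<comment> \<open>Adding \<open>Leib\<close> makes \<open>engel\<close> applicable without
    changing the set of left multiplications.\<close>
  let ?H = "{x + y | x y. x \<in> P \<and> y \<in> Leib}"
  have act: "bracket (x + l) v = bracket x v" if "l \<in> Leib" for x l v
    using that by (simp add: bracket_add_left bracket_Leib_left)
  have HE: "\<exists>x\<in>P. \<exists>l\<in>Leib. h = x + l \<and> bracket h = bracket x" if "h \<in> ?H" for h
    using that act by (auto simp: fun_eq_iff)
  have "bracket h h' \<in> ?H" if hh: "h \<in> ?H" "h' \<in> ?H" for h h'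
  proof -
    obtain x where "x \<in> P" "bracket h = bracket x" using HE[OF hh(1)] by blast
    moreover obtain x' l' where "h' = x' + l'" "x' \<in> P" "l' \<in> Leib" using hh(2) by blast
    ultimately have "bracket h h' = bracket x x' + bracket x l'"
      "bracket x x' \<in> P" "bracket x l' \<in> Leib"
      using cP bracket_Leib_right by (auto simp: bracket_add_right)
    then show ?thesis by blast
  qed
  moreover have "Leib \<subseteq> ?H"
  proof
    fix l assume "l \<in> Leib"
    moreover have "l = 0 + l" by simp
    ultimately show "l \<in> ?H" using subspace_0[OF P(1)] by blast
  qed
  ultimately have H: "subalgebra_with_Leib ?H"
    using subspace_sums[OF P(1) subspace_Leib] by (auto simp: subalgebra_with_Leib_def)
  have nilH: "\<exists>N. \<forall>v. (bracket h ^^ N) v = 0" if "h \<in> ?H" for h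
    using HE[OF that] nil by metis
  have invH: "invariant_under ?H U" if U: "invariant_under P U" for U
    unfolding invariant_under_def
  proof (intro ballI)
    fix h u assume h: "h \<in> ?H" and u: "u \<in> U"
    obtain x where "x \<in> P" "bracket h = bracket x" using HE[OF h] by blast
    then show "bracket h u \<in> U" using U u by (simp add: invariant_under_def)
  qed
  let ?Q = "\<lambda>U. subspace U \<and> U \<subset> P \<and> invariant_under P U"
  have "?Q {0}" using ne subspace_0[OF P(1)] by (auto simp: invariant_under_def)
  then obtain U where U: "?Q U" and max: "\<And>T. ?Q T \<Longrightarrow> \<not> U \<subset> T"
    by (rule maximal_subspace) auto
  then have sU: "subspace U" by blast
  have "invariant_under ?H U" "invariant_under ?H P"
    using invH U cP by (auto simp: invariant_under_def)
  then obtain w where w: "w \<in> P - U" "\<And>h. h \<in> ?H \<Longrightarrow> bracket h w \<in> U"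
    using engel[OF H nilH sU P(1)] U by blast
  have "x = x + 0" for x :: 'b by simp
  then have "P \<subseteq> ?H" using subspace_0[OF subspace_Leib] by blast
  then have wP: "bracket x w \<in> U" if "x \<in> P" for x using w(2) that by blast
  let ?T = "span (insert w U)"
  have T: "bracket x t \<in> U" if "x \<in> P" "t \<in> ?T" for x t
  proof -
    obtain u c where t: "t = u + scale c w" "u \<in> U"
      using \<open>t \<in> ?T\<close> unfolding mem_span_insert[OF sU] by blast
    have "bracket x u \<in> U" using U t that by (auto simp: invariant_under_def)
    then show ?thesis
      unfolding t bracket_add_right bracket_scale_right
      using wP[OF \<open>x \<in> P\<close>] by (intro subspace_add[OF sU] subspace_scale[OF sU])
  qed
  have "invariant_under P ?T"
    using T subset_span_insert unfolding invariant_under_def by blast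
  moreover have "?T \<subseteq> P" using w U P(1) by (intro span_minimal) auto
  moreover have "U \<subset> ?T" using w subset_span_insert by blast
  ultimately have "?T = P" using max[of ?T] by blast
  then have "bracket_span P P \<subseteq> U"
    unfolding bracket_span_def using T by (intro span_minimal sU) blast
  then show False using P(2) U by blast
qed

text \<open>The derived series decreases, so a term of least dimension is perfect. It lies in
  \<open>[I, I]\<close> and is therefore zero.\<close>

lemma solvable_of_nilpotent_derived:
  assumes I: "leibniz_ideal I" and nil: "\<And>x. x \<in> bracket_span I I \<Longrightarrow> \<exists>N. \<forall>v. (bracket x ^^ N) v = 0"
  shows "solvable I"
proof -
  let ?D = "derived_series I"
  have sI: "subspace I" using I by (simp add: leibniz_ideal_def)
  have step: "?D (Suc n) \<subseteq> ?D n" for n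
  proof (induction n)
    case 0
    then show ?case using I unfolding derived_series.simps bracket_span_def leibniz_ideal_def
      by (intro span_minimal) auto
  next
    case (Suc n)
    then show ?case
      using bracket_span_mono[of "?D (Suc n)" "?D n" "?D (Suc n)" "?D n"] by simp
  qed
  obtain n where n: "\<And>m. dim (?D n) \<le> dim (?D m)"
    using ex_has_least_nat[of "\<lambda>_. True" 0 "\<lambda>n. dim (?D n)"] by auto
  have "?D (Suc n) = ?D n"
    using subspace_dim_equal[OF subspace_derived_series[OF sI] subspace_derived_series[OF sI] step n] .
  then have perfect: "bracket_span (?D n) (?D n) = ?D n" by simp
  have "?D m \<subseteq> I" for m by (induction m) (use step in auto)
  then have "?D n \<subseteq> bracket_span I I"
    using bracket_span_mono[of "?D n" I "?D n" I] perfect by simp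
  then have "?D n = {0}"
    using perfect_nilpotent_trivial[OF subspace_derived_series[OF sI] perfect] nil by blast
  then show ?thesis unfolding solvable_def by blast
qed

section \<open>The center of the quotient and representation of functionals\<close>

lemma quot_center_trivial:
  assumes semisimple
  shows "quot_center = {Leib}"
proof
  \<comment> \<open>The preimage of the center of the quotient; its derived algebra lies in
    \<open>Leib\<close>, on which the bracket vanishes.\<close>
  let ?J = "{x. \<forall>y. bracket x y \<in> Leib}"
  have sJ: "subspace ?J"
    using subspace_Leib unfolding subspace_def by (auto simp: bracket_add_left bracket_scale_left)
  have JI: "leibniz_ideal ?J"
    unfolding leibniz_ideal_def
  proof (intro conjI ballI allI sJ)
    fix x y assume x: "x \<in> ?J"
    show "bracket x y \<in> ?J" using x bracket_Leib_left subspace_0[OF subspace_Leib] by auto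
    have "bracket y x \<in> Leib"
      using subspace_diff[OF subspace_Leib bracket_sym_in_Leib[of y x], of "bracket x y"] x by simp
    then show "bracket y x \<in> ?J" using bracket_Leib_left subspace_0[OF subspace_Leib] by auto
  qed
  have "derived_series ?J 1 \<subseteq> Leib"
    unfolding One_nat_def derived_series.simps bracket_span_def
    by (intro span_minimal subspace_Leib) auto
  then have "derived_series ?J 2 \<subseteq> bracket_span Leib Leib"
    by (simp add: numeral_2_eq_2 bracket_span_mono)
  also have "\<dots> \<subseteq> {0}"
    unfolding bracket_span_def by (intro span_minimal) (auto simp: bracket_Leib_left)
  finally have "derived_series ?J 2 = {0}"
    using subspace_0[OF subspace_derived_series[OF sJ]] by blast
  then have "?J \<subseteq> Leib"
    using rad_upper[OF JI] assms unfolding solvable_def semisimple_def by blast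
  have coset: "x \<in> Leib" if "x +o Leib = Leib" for x
    using that subspace_0[OF subspace_Leib] by (force simp: elt_set_plus_def)
  have coset': "x +o Leib = Leib" if x: "x \<in> Leib" for x
  proof
    show "x +o Leib \<subseteq> Leib" using x subspace_add[OF subspace_Leib] by (auto simp: elt_set_plus_def)
    show "Leib \<subseteq> x +o Leib"
    proof
      fix z assume "z \<in> Leib"
      then have "z - x \<in> Leib" "z = x + (z - x)" using x subspace_diff[OF subspace_Leib] by auto
      then show "z \<in> x +o Leib" unfolding elt_set_plus_def by blast
    qed
  qed
  show "quot_center \<subseteq> {Leib}"
  proof
    fix X' assume X': "X' \<in> quot_center"
    then obtain x where x: "X' = x +o Leib" unfolding quot_center_def quot_def by blast
    have "bracket x y +o Leib = Leib" for y
      using X' unfolding quot_center_def x quot_bracket_coset[symmetric] by (auto simp: quot_def)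
    then have "x \<in> Leib" using \<open>?J \<subseteq> Leib\<close> coset by blast
    then show "X' \<in> {Leib}" using x coset' by simp
  qed
  note L0 = coset'[OF subspace_0[OF subspace_Leib]]
  have "quot_bracket Leib (y +o Leib) = Leib" for y
    using quot_bracket_coset[of 0 y] L0 by simp
  moreover have "Leib \<in> quot"
    unfolding quot_def using rangeI[of "\<lambda>x. x +o Leib" 0] L0 by simp
  ultimately show "{Leib} \<subseteq> quot_center"
    unfolding quot_center_def by (auto simp: quot_def)
qed

end

text \<open>For a basis \<open>D\<close> extending a basis \<open>C\<close> of the radical, replacing the coordinates outside \<open>C\<close> by
  the values of the form on \<open>D - C\<close> is injective, hence surjective.\<close>

lemma (in finite_dimensional_vector_space) functional_of_bilinear_form:
  assumes B: "\<And>x y z. B (x + y) z = B x z + B y z" "\<And>c x z. B (scale c x) z = c * B x z"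
    and sym: "\<And>x y. B x y = B y x"
    and F: "\<And>x y. F (x + y) = F x + F y" "\<And>c x. F (scale c x) = c * F x"
    and rad: "\<And>x. (\<And>y. B x y = 0) \<Longrightarrow> F x = (0 :: 'a)"
  obtains y where "\<And>x. F x = B y x"
proof -
  let ?R = "{x. \<forall>y. B x y = 0}"
  obtain C where C: "C \<subseteq> ?R" "independent C" "?R \<subseteq> span C" by (rule basis_exists)
  define D where "D = extend_basis C"
  have D: "C \<subseteq> D" "independent D" "span D = UNIV"
    unfolding D_def using C(2)
    by (simp_all add: extend_basis_superset independent_extend_basis span_extend_basis)
  have fD: "finite D" by (rule finiteI_independent[OF D(2)])
  have r: "representation D (x + y) b = representation D x b + representation D y b"
    "representation D (scale c x) b = c * representation D x b" for x y b c
    using D by (simp_all add: representation_add representation_scale)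
  have expand: "v = (\<Sum>b\<in>D. scale (representation D v b) b)" for v
    by (rule sum_representation_eq[symmetric]) (use D fD in auto)
  define T where "T v = (\<Sum>b\<in>D. scale (if b \<in> C then representation D v b else B v b) b)" for v
  have rep_sum: "representation D (\<Sum>b\<in>D. scale (c b) b) d = c d" if "d \<in> D" for c d
  proof -
    have "representation D (\<Sum>b\<in>S. scale (c b) b) d = (\<Sum>b\<in>S. if b = d then c b else 0)"
      if "S \<subseteq> D" "finite S" for S using that(2,1)
      by (induction S rule: finite_induct)
        (auto simp: r representation_zero representation_basis[OF D(2)])
    from this[of D] show ?thesis using that fD by simp
  qed
  have lT: "endo T"
    unfolding endo_iff T_def
    by (auto simp: r B scale_sum_right sum.distrib[symmetric] scale_left_distrib[symmetric] intro!: sum.cong)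
  \<comment> \<open>If \<open>T v = 0\<close>, then \<open>v\<close> pairs to zero with all of
    \<open>D\<close>. So \<open>v\<close> lies in \<open>span C\<close> and has no coordinates
    outside \<open>C\<close>; those on \<open>C\<close> are zero by the form of
    \<open>T\<close>.\<close>
  have "v = 0" if "T v = 0" for v
  proof -
    have c: "(if d \<in> C then representation D v d else B v d) = 0" if "d \<in> D" for d
      using rep_sum[OF that, of "\<lambda>b. if b \<in> C then representation D v b else B v b"] \<open>T v = 0\<close>
      by (simp add: T_def representation_zero)
    have "B v b = 0" if "b \<in> D" for b
      using c[OF that] C(1) sym[of v b] by (auto split: if_splits)
    then have Bb: "B b v = 0" if "b \<in> D" for b using that sym by metis
    have B0: "B 0 z = 0" for z using B(2)[of 0 0 z] by simp
    have Bs: "B (\<Sum>b\<in>S. scale (k b) b) v = (\<Sum>b\<in>S. k b * B b v)" for k S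
      by (induction S rule: infinite_finite_induct) (simp_all add: B B0)
    have "B u v = 0" for u
      using Bs[of "representation D u" D] expand[of u] Bb by simp
    then have "v \<in> span C" using C(3) sym by auto
    then have "representation D v = representation C v"
      by (rule representation_extend[OF D(2) _ D(1)])
    then have "representation D v d = 0" if "d \<notin> C" for d
      using that representation_ne_zero[of C v d] by auto
    then have "representation D v d = 0" if "d \<in> D" for d using c[OF that] by (cases "d \<in> C") auto
    then show ?thesis using expand[of v] by simp
  qed
  then have "inj T"
    using endo_diff[OF lT] by (intro injI) (metis eq_iff_diff_eq_0)
  then have "surj T" using linear_inj_imp_surj lT by (simp add: endo_def)
  then obtain y where y: "T y = (\<Sum>b\<in>D. scale (if b \<in> C then 0 else F b) b)" by (metis surjD)
  have eq: "F b = B y b" if "b \<in> D" for b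
  proof (cases "b \<in> C")
    case True
    then have "\<And>z. B b z = 0" using C(1) by auto
    then show ?thesis using rad[of b] sym by metis
  next
    case False
    then show ?thesis
      using rep_sum[OF that, of "\<lambda>b. if b \<in> C then 0 else F b"]
        rep_sum[OF that, of "\<lambda>b. if b \<in> C then representation D y b else B y b"] y
      by (simp add: T_def)
  qed
  have F0: "F 0 = 0" and B0: "B 0 z = 0" for z using F(2)[of 0 0] B(2)[of 0 0 z] by simp_all
  have Fs: "F (\<Sum>b\<in>S. scale (k b) b) = (\<Sum>b\<in>S. k b * F b)"
    and Bs: "B (\<Sum>b\<in>S. scale (k b) b) z = (\<Sum>b\<in>S. k b * B b z)" for k S z
    by (induction S rule: infinite_finite_induct) (simp_all add: F F0 B B0)
  have "F x = B y x" for x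
  proof -
    have "F x = (\<Sum>b\<in>D. representation D x b * F b)" using expand[of x] Fs by metis
    also have "\<dots> = (\<Sum>b\<in>D. representation D x b * B b y)" using eq sym by (intro sum.cong) auto
    also have "\<dots> = B x y" using expand[of x] Bs by metis
    finally show ?thesis using sym by metis
  qed
  then show thesis by (rule that)
qed

section \<open>Invariance of the trace form and inner derivations\<close>

context leibniz_algebra_char_0
begin

lemma trace_form_sym: "trace_form x y = trace_form y x"
  unfolding trace_form_def by (rule op_trace_commute[OF endo_bracket endo_bracket])

lemma trace_form_add_left: "trace_form (x + y) z = trace_form x z + trace_form y z"
  by (simp add: trace_form_def bracket_add_left op_trace_add)

lemma trace_form_scale_left: "trace_form (scale c x) z = c * trace_form x z"
  by (simp add: trace_form_def bracket_scale_left op_trace_scale)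

text \<open>Expand both inner brackets as commutators of left multiplications and rotate one of the
  traces.\<close>

lemma trace_form_invariant: "trace_form (bracket x y) z = trace_form x (bracket y z)"
  using op_trace_commute[OF endo_bracket[of y] endo_comp[OF endo_bracket[of x] endo_bracket[of z]]]
  unfolding trace_form_def bracket_bracket_left bracket_diff_right op_trace_diff by simp

lemma trace_radical_ideal: "leibniz_ideal trace_radical"
proof -
  have "trace_form 0 z = 0" for z using trace_form_scale_left[of 0 0 z] by simp
  then have "subspace trace_radical"
    unfolding subspace_def trace_radical_def
    by (auto simp: trace_form_add_left trace_form_scale_left)
  moreover have "bracket x y \<in> trace_radical" "bracket y x \<in> trace_radical"
    if x: "x \<in> trace_radical" for x y
  proof -
    show "bracket x y \<in> trace_radical"
      using x by (auto simp: trace_radical_def trace_form_invariant)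
    have "trace_form (bracket y x) z = trace_form x (bracket z y)" for z
      by (metis trace_form_invariant trace_form_sym)
    then show "bracket y x \<in> trace_radical" using x by (auto simp: trace_radical_def)
  qed
  ultimately show ?thesis unfolding leibniz_ideal_def by blast
qed

lemma trace_radical_solvable: "solvable trace_radical"
  using solvable_of_nilpotent_derived[OF trace_radical_ideal] cartan_nilpotent
    bracket_span_mono[of trace_radical trace_radical trace_radical UNIV] by blast

lemma derivation_inner:
  assumes semisimple and \<delta>: "derivation \<delta>"
  shows "inner_derivation \<delta>"
proof -
  have RL: "trace_radical \<subseteq> Leib"
    using rad_upper[OF trace_radical_ideal trace_radical_solvable] assms(1)
    by (simp add: semisimple_def)
  have l\<delta>: "endo \<delta>" and d\<delta>: "\<And>x y. \<delta> (bracket x y) = bracket (\<delta> x) y + bracket x (\<delta> y)"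
    using \<delta> by (auto simp: derivation_def endo_def)
  let ?F = "\<lambda>x. op_trace (\<lambda>v. \<delta> (bracket x v))"
  have "?F (x + y) = ?F x + ?F y" for x y
    by (simp add: bracket_add_left endo_add[OF l\<delta>] op_trace_add)
  moreover have "?F (scale c x) = c * ?F x" for c x
    by (simp add: bracket_scale_left endo_scale[OF l\<delta>] op_trace_scale)
  moreover have "?F x = 0" if "\<And>y. trace_form x y = 0" for x
  proof -
    have "x \<in> Leib" using that RL by (auto simp: trace_radical_def)
    then show ?thesis by (simp add: bracket_Leib_left endo_0[OF l\<delta>])
  qed
  ultimately obtain y where y: "\<And>x. ?F x = trace_form y x"
    using functional_of_bilinear_form[of trace_form ?F]
      trace_form_add_left trace_form_scale_left trace_form_sym by blast
  define \<epsilon> where "\<epsilon> v = \<delta> v - bracket y v" for v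
  have l\<epsilon>: "endo \<epsilon>"
    by (auto simp: \<epsilon>_def endo_iff endo_add[OF l\<delta>] endo_scale[OF l\<delta>] bracket_add_right
        bracket_scale_right scale_right_diff_distrib)
  \<comment> \<open>As \<open>\<epsilon>\<close> is a derivation, \<open>L_(\<epsilon> x)\<close> is
    the commutator of \<open>\<epsilon>\<close> with \<open>L_x\<close>.\<close>
  have d\<epsilon>: "bracket (\<epsilon> x) v = \<epsilon> (bracket x v) - bracket x (\<epsilon> v)" for x v
    using left_leibniz[of y x v] bracket_add_left[of "\<epsilon> x" "bracket y x" v]
    by (simp add: \<epsilon>_def d\<delta> bracket_diff_right)
  have t\<epsilon>: "op_trace (\<lambda>v. \<epsilon> (bracket x v)) = 0" for x
    unfolding \<epsilon>_def op_trace_diff using y[of x] by (simp add: trace_form_def)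
  have "trace_form (\<epsilon> x) z = 0" for x z
  proof -
    \<comment> \<open>Cyclicity turns \<open>tr([\<epsilon>, L_x] L_z)\<close> into
      \<open>tr(\<epsilon> [L_x, L_z])\<close>, and that commutator is the left multiplication by
      \<open>bracket x z\<close>.\<close>
    have "op_trace (\<lambda>v. bracket x (\<epsilon> (bracket z v))) = op_trace (\<lambda>v. \<epsilon> (bracket z (bracket x v)))"
      using op_trace_commute[OF endo_bracket[of x] endo_comp[OF l\<epsilon> endo_bracket[of z]]] .
    then have "trace_form (\<epsilon> x) z = op_trace (\<lambda>v. \<epsilon> (bracket (bracket x z) v))"
      unfolding trace_form_def d\<epsilon> bracket_bracket_left endo_diff[OF l\<epsilon>] op_trace_diff by simp
    then show ?thesis using t\<epsilon> by simp
  qed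
  then have "\<epsilon> x \<in> Leib" for x using RL by (auto simp: trace_radical_def)
  then have "range (\<lambda>v. \<delta> v - bracket y v) \<subseteq> Leib" by (auto simp: \<epsilon>_def)
  then show ?thesis using \<delta> unfolding inner_derivation_def by blast
qed

end

theorem theorem3p3:
  fixes scale :: "'a::field_char_0 \<Rightarrow> 'b::ab_group_add \<Rightarrow> 'b"
    and Basis :: "'b set"
    and bracket :: "'b \<Rightarrow> 'b \<Rightarrow> 'b"
  assumes "leibniz_algebra scale Basis bracket"
    and "leibniz_algebra.semisimple scale bracket"
  shows "leibniz_algebra.complete_leibniz scale bracket"
proof -
  interpret leibniz_algebra_char_0 scale Basis bracket
    using assms(1) by (rule leibniz_algebra_char_0.intro)
  show ?thesis
    unfolding complete_leibniz_def using assms(2) quot_center_trivial derivation_inner by blast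
qed

end
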